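(* Let $\mathbb{F}$ be a field, let $\mathcal{C}_w=(\mathcal{C},w)$ be a weighted simplex and $d\in\mathbb{N}$. For any minimal spanning $d$-tree $\mathtt{MST}^{(d)}$ of $\mathcal{C}_w$ and every $\alpha\in\mathbb{R}$, the subcomplex $\mathtt{MST}^{(d)}_\alpha=\{A\in\mathtt{MST}^{(d)} : w(A)\le\alpha\}$ is a $(d-1)$-fitting $d$-spanning $d$-forest in $\mathcal{C}_{w\le\alpha}$, and it has minimal total weight among all $(d-1)$-fitting $d$-spanning $d$-forests in $\mathcal{C}_{w\le\alpha}$.
   Context: Complexes. $\mathbb{N}$ contains $0$. All simplicial complexes are finite and are represented as sets of non-empty faces (each face a set of vertices; the empty complex is allowed). $\mathcal{Q}^{(k)}$ is the $k$-skeleton of $\mathcal{Q}$ (empty for $k<0$). Homology is unreduced simplicial homology with coefficients in $\mathbb{F}$, with $H_k=0$ for $k<0$. Let $\mathcal{Q}$ be a complex, $\mathcal{S}$ a subcomplex and $k$ an integer. $\mathcal{S}$ is $k$-fitting in $\mathcal{Q}$ if the inclusion induces isomorphisms $H_i(\mathcal{S})\to H_i(\mathcal{Q})$ for all $i\in\mathbb{N}$, $i\le k$. For $k\in\mathbb{N}$ and $\mathcal{S}$ of dimension at most $k$: $\mathcal{S}$ is $k$-spanning in $\mathcal{Q}$ if $\mathcal{S}^{(k-1)}=\mathcal{Q}^{(k-1)}$; it is a $k$-forest if $H_k(\mathcal{S})=0$; it is a $k$-tree if it is a $k$-forest and the unique map to a point induces an isomorphism $H_{k-1}(\mathcal{S})\to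 H_{k-1}(\bullet)$. (Forests, trees and spanning complexes thus have dimension at most $k$.) A spanning $k$-tree is a $k$-spanning $k$-tree. Weighted simplices. A weighted simplex $\mathcal{C}_w=(\mathcal{C},w)$ is a non-empty finite set $\mathcal{C}$ with a map $w$ from the set $\mathscr{P}_+(\mathcal{C})$ of non-empty subsets of $\mathcal{C}$ to $\mathbb{R}_{\ge0}$ such that $\emptyset\ne A\subseteq B$ implies $w(A)\le w(B)$. As a complex, $\mathcal{C}_w$ is the full simplex $\mathscr{P}_+(\mathcal{C})$. For $\alpha\in\mathbb{R}$, $\mathcal{C}_{w\le\alpha}=\{A\in\mathscr{P}_+(\mathcal{C}) : w(A)\le\alpha\}$, a subcomplex. The total weight of a set of faces is the sum of the weights of its members (over faces of all dimensions). A minimal spanning $d$-tree of $\mathcal{C}_w$ is a spanning $d$-tree of $\mathcal{C}_w$ of minimal total weight. *)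

theory Defs
  imports Complex_Main "HOL-Algebra.Elementary_Groups"
begin

section \<open>Finite simplicial complexes\<close>

definition simplicial_complex :: "'v set set \<Rightarrow> bool" where
  "simplicial_complex K \<longleftrightarrow>
     finite K \<and> (\<forall>A\<in>K. finite A \<and> A \<noteq> {}) \<and> (\<forall>A\<in>K. \<forall>B. B \<noteq> {} \<and> B \<subseteq> A \<longrightarrow> B \<in> K)"

definition subcomplex :: "'v set set \<Rightarrow> 'v set set \<Rightarrow> bool" where
  "subcomplex S Q \<longleftrightarrow> simplicial_complex S \<and> simplicial_complex Q \<and> S \<subseteq> Q"

text \<open>A face with \<open>k + 1\<close> vertices has dimension \<open>k\<close>. Degrees are integers; since faces are
  non-empty, there are no faces, hence no nonzero chains and no homology, in negative degree.\<close>

definition skeleton :: "int \<Rightarrow> 'v set set \<Rightarrow> 'v set set" where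
  "skeleton k K = {A \<in> K. int (card A) \<le> k + 1}"

definition dim_at_most :: "nat \<Rightarrow> 'v set set \<Rightarrow> bool" where
  "dim_at_most k K \<longleftrightarrow> (\<forall>A\<in>K. card A \<le> k + 1)"


section \<open>Simplicial homology with coefficients in a field\<close>

text \<open>As usual, faces are oriented by a total order of the vertices. One such order is chosen once
  and for all on every type; up to isomorphism, homology does not depend on the choice.\<close>

definition vertex_order :: "'v rel" where
  "vertex_order = (SOME r. linear_order r)"

lemma linear_order_vertex_order: "linear_order (vertex_order :: 'v rel)"
proof -
  obtain r :: "'v rel" where "well_order_on UNIV r"
    using well_order_on by blast
  then have "linear_order r"
    by (simp add: well_order_on_def)
  then show ?thesis
    unfolding vertex_order_def by (rule someI)
qed

definition vless :: "'v \<Rightarrow> 'v \<Rightarrow> bool" where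
  "vless u v \<longleftrightarrow> (u, v) \<in> vertex_order \<and> u \<noteq> v"

text \<open>A \<open>k\<close>-chain is given by its coefficients: \<open>c A\<close> is the coefficient of the face
  \<open>A = {v\<^sub>0 < \<dots> < v\<^sub>k}\<close>, oriented as \<open>[v\<^sub>0, \<dots>, v\<^sub>k]\<close>.\<close>

definition chains :: "'v set set \<Rightarrow> int \<Rightarrow> ('v set \<Rightarrow> 'f::field) set" where
  "chains K k = {c. \<forall>A. c A \<noteq> 0 \<longrightarrow> A \<in> K \<and> int (card A) = k + 1}"

text \<open>The linear extension of
  \<open>[v\<^sub>0, \<dots>, v\<^sub>k] \<mapsto> \<Sum>\<^sub>i (-1)\<^sup>i [v\<^sub>0, \<dots>, v\<^sub>i\<^sub>-\<^sub>1, v\<^sub>i\<^sub>+\<^sub>1, \<dots>, v\<^sub>k]\<close>, read off at the face \<open>B\<close>; the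
  exponent is the position of the deleted vertex. The case \<open>B = {}\<close> makes the boundary of
  \<open>0\<close>-chains vanish, so homology is unreduced.\<close>

definition boundary :: "'v set set \<Rightarrow> ('v set \<Rightarrow> 'f::field) \<Rightarrow> 'v set \<Rightarrow> 'f" where
  "boundary K c B =
     (if B = {} then 0
      else \<Sum>A\<in>K. \<Sum>v | v \<in> A \<and> A - {v} = B. (-1) ^ card {u \<in> A. vless u v} * c A)"

definition cycles :: "'v set set \<Rightarrow> int \<Rightarrow> ('v set \<Rightarrow> 'f::field) set" where
  "cycles K k = {c \<in> chains K k. boundary K c = (\<lambda>_. 0)}"

definition boundaries :: "'v set set \<Rightarrow> int \<Rightarrow> ('v set \<Rightarrow> 'f::field) set" where
  "boundaries K k = boundary K ` chains K (k + 1)"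

definition cycle_group :: "'v set set \<Rightarrow> int \<Rightarrow> ('v set \<Rightarrow> 'f::field) monoid" where
  "cycle_group K k =
     \<lparr>carrier = cycles K k, monoid.mult = (\<lambda>c c' A. c A + c' A), one = (\<lambda>_. 0)\<rparr>"

text \<open>Only the additive group of the vector space is recorded. All maps considered between homology
  groups are induced by linear chain maps and hence are linear, so such a map is an isomorphism
  of groups iff it is an isomorphism of vector spaces.\<close>

definition homology_group :: "'v set set \<Rightarrow> int \<Rightarrow> ('v set \<Rightarrow> 'f::field) set monoid" where
  "homology_group K k = cycle_group K k Mod boundaries K k"

text \<open>The chain map of a simplicial map \<open>f\<close> defined on \<open>K\<close>:
  \<open>[v\<^sub>0, \<dots>, v\<^sub>k] \<mapsto> [f v\<^sub>0, \<dots>, f v\<^sub>k]\<close>, which is \<open>0\<close> if \<open>f\<close> identifies two of the \<open>v\<^sub>i\<close>. The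
  sign is that of the permutation sorting \<open>f v\<^sub>0, \<dots>, f v\<^sub>k\<close>, given by its inversions.\<close>

definition chain_map ::
    "('v \<Rightarrow> 'u) \<Rightarrow> 'v set set \<Rightarrow> ('v set \<Rightarrow> 'f::field) \<Rightarrow> 'u set \<Rightarrow> 'f" where
  "chain_map f K c B =
     (\<Sum>A | A \<in> K \<and> inj_on f A \<and> f ` A = B.
        (-1) ^ card {(u, v). u \<in> A \<and> v \<in> A \<and> vless u v \<and> vless (f v) (f u)} * c A)"

text \<open>The class of a cycle \<open>z\<close> of \<open>K\<close> is mapped to the class of its image in \<open>L\<close>.\<close>

definition homology_map ::
    "('v \<Rightarrow> 'u) \<Rightarrow> 'v set set \<Rightarrow> 'u set set \<Rightarrow> int \<Rightarrow>
       ('v set \<Rightarrow> 'f::field) set \<Rightarrow> ('u set \<Rightarrow> 'f) set" where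
  "homology_map f K L k X =
     the_elem ((\<lambda>z. boundaries L k #>\<^bsub>cycle_group L k\<^esub> chain_map f K z) ` X)"

definition induces_homology_iso ::
    "'f::field itself \<Rightarrow> ('v \<Rightarrow> 'u) \<Rightarrow> 'v set set \<Rightarrow> 'u set set \<Rightarrow> int \<Rightarrow> bool" where
  "induces_homology_iso F f K L k \<longleftrightarrow>
     (homology_map f K L k :: ('v set \<Rightarrow> 'f) set \<Rightarrow> ('u set \<Rightarrow> 'f) set)
       \<in> iso (homology_group K k) (homology_group L k)"

definition homology_vanishes :: "'f::field itself \<Rightarrow> 'v set set \<Rightarrow> int \<Rightarrow> bool" where
  "homology_vanishes F K k \<longleftrightarrow>
     trivial_group (homology_group K k :: ('v set \<Rightarrow> 'f) set monoid)"

definition point_complex :: "unit set set" where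
  "point_complex = {{()}}"


section \<open>Fitting and spanning subcomplexes, forests and trees\<close>

definition fitting :: "'f::field itself \<Rightarrow> int \<Rightarrow> 'v set set \<Rightarrow> 'v set set \<Rightarrow> bool" where
  "fitting F k Q S \<longleftrightarrow>
     subcomplex S Q \<and> (\<forall>i::nat. int i \<le> k \<longrightarrow> induces_homology_iso F id S Q (int i))"

definition spanning :: "nat \<Rightarrow> 'v set set \<Rightarrow> 'v set set \<Rightarrow> bool" where
  "spanning k Q S \<longleftrightarrow>
     subcomplex S Q \<and> dim_at_most k S \<and> skeleton (int k - 1) S = skeleton (int k - 1) Q"

definition forest :: "'f::field itself \<Rightarrow> nat \<Rightarrow> 'v set set \<Rightarrow> bool" where
  "forest F k S \<longleftrightarrow>
     simplicial_complex S \<and> dim_at_most k S \<and> homology_vanishes F S (int k)"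

definition tree :: "'f::field itself \<Rightarrow> nat \<Rightarrow> 'v set set \<Rightarrow> bool" where
  "tree F k S \<longleftrightarrow>
     forest F k S \<and> induces_homology_iso F (\<lambda>_. ()) S point_complex (int k - 1)"

definition spanning_tree :: "'f::field itself \<Rightarrow> nat \<Rightarrow> 'v set set \<Rightarrow> 'v set set \<Rightarrow> bool" where
  "spanning_tree F k Q S \<longleftrightarrow> spanning k Q S \<and> tree F k S"

definition fitting_spanning_forest ::
    "'f::field itself \<Rightarrow> nat \<Rightarrow> 'v set set \<Rightarrow> 'v set set \<Rightarrow> bool" where
  "fitting_spanning_forest F k Q S \<longleftrightarrow>
     fitting F (int k - 1) Q S \<and> spanning k Q S \<and> forest F k S"


section \<open>Weighted simplices\<close>

definition full_simplex :: "'v set \<Rightarrow> 'v set set" where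
  "full_simplex C = {A. A \<noteq> {} \<and> A \<subseteq> C}"

text \<open>The values of \<open>w\<close> outside \<open>full_simplex C\<close> are irrelevant.\<close>

definition weighted_simplex :: "'v set \<Rightarrow> ('v set \<Rightarrow> real) \<Rightarrow> bool" where
  "weighted_simplex C w \<longleftrightarrow>
     finite C \<and> C \<noteq> {} \<and> (\<forall>A\<in>full_simplex C. 0 \<le> w A) \<and>
     (\<forall>A\<in>full_simplex C. \<forall>B\<in>full_simplex C. A \<subseteq> B \<longrightarrow> w A \<le> w B)"

definition sublevel :: "'v set \<Rightarrow> ('v set \<Rightarrow> real) \<Rightarrow> real \<Rightarrow> 'v set set" where
  "sublevel C w \<alpha> = {A \<in> full_simplex C. w A \<le> \<alpha>}"

definition total_weight :: "('v set \<Rightarrow> real) \<Rightarrow> 'v set set \<Rightarrow> real" where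
  "total_weight w S = (\<Sum>A\<in>S. w A)"

definition minimal_spanning_tree ::
    "'f::field itself \<Rightarrow> nat \<Rightarrow> 'v set \<Rightarrow> ('v set \<Rightarrow> real) \<Rightarrow> 'v set set \<Rightarrow> bool" where
  "minimal_spanning_tree F d C w M \<longleftrightarrow>
     spanning_tree F d (full_simplex C) M \<and>
     (\<forall>T. spanning_tree F d (full_simplex C) T \<longrightarrow> total_weight w M \<le> total_weight w T)"

end

theory Submission
  imports Defs
begin

text \<open>A \<open>d\<close>-spanning complex is determined by its \<open>d\<close>-faces, and the boundaries of the \<open>d\<close>-faces of
  the simplex represent a matroid. Since the simplex is acyclic, spanning \<open>d\<close>-trees correspond to
  the bases of this matroid; likewise the \<open>(d - 1)\<close>-fitting \<open>d\<close>-spanning \<open>d\<close>-forests of a sublevel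
  complex correspond to the bases of its restriction to the \<open>d\<close>-faces of weight at most \<open>\<alpha>\<close>. By
  exchange, a minimal basis restricts to a basis of the sublevel; replacing this part by another
  basis of the sublevel gives a basis of the whole, which yields minimality.\<close>

text \<open>For a \<open>d\<close>-spanning complex, being a basis becomes two conditions on chains:
  there is no nonzero \<open>d\<close>-cycle (independence), and every
  \<open>(d - 1)\<close>-boundary of the ambient complex is already a boundary (generation). Both
  are proved by explicit exchanges of chains rather than by counting dimensions. To add and compare
  chains of different subcomplexes, all boundaries are taken with the operator of one ambient
  complex.

  Two features of the definitions shape the rest. Homology is given by quotient groups and cosets,
  so isomorphisms and vanishing have to be translated into inclusions between sets of cycles and
  boundaries. And homology is unreduced: \<open>boundary\<close> is zero at the empty face, so in
  degree \<open>0\<close> the simplex is acyclic only for cycles whose coefficients sum to zero.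
  This condition has to be carried along by a second operator and is matched, for
  \<open>d = 1\<close>, with the map to a point.\<close>

lemma vless_irrefl [simp]: "\<not> vless v v"
  by (simp add: vless_def)

lemma vless_asym: "vless u v \<Longrightarrow> \<not> vless v u"
  using linear_order_vertex_order[where 'v = 'a]
  unfolding vless_def linear_order_on_def partial_order_on_def antisym_def by blast

lemma vless_trans: "vless u v \<Longrightarrow> vless v x \<Longrightarrow> vless u x"
  using linear_order_vertex_order[where 'v = 'a] vless_asym[of u v]
  unfolding vless_def linear_order_on_def partial_order_on_def preorder_on_def trans_def by blast

lemma vless_linear: "u \<noteq> v \<Longrightarrow> vless u v \<or> vless v u"
  using linear_order_vertex_order[where 'v = 'a]
  unfolding vless_def linear_order_on_def total_on_def by blast

text \<open>Supplies the apex of the cone that contracts the simplex.\<close>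

lemma finite_has_vless_least:
  assumes "finite C" "C \<noteq> {}"
  obtains m where "m \<in> C" "\<And>u. u \<in> C \<Longrightarrow> u \<noteq> m \<Longrightarrow> vless m u"
proof -
  have "\<exists>m\<in>C. \<forall>u\<in>C. u \<noteq> m \<longrightarrow> vless m u"
    using assms
  proof (induction rule: finite_ne_induct)
    case (insert x F)
    then obtain m where m: "m \<in> F" "\<forall>u\<in>F. u \<noteq> m \<longrightarrow> vless m u" by blast
    show ?case
    proof (cases "vless x m")
      case True
      then show ?thesis using m vless_trans by (metis insert_iff)
    next
      case False
      then show ?thesis using m vless_linear by (metis insert_iff)
    qed
  qed auto
  then show ?thesis using that by blast
qed


section \<open>The augmented boundary operator of a simplex\<close>

text \<open>In contrast to \<^const>\<open>boundary\<close>, the value at the empty face is the augmentation.\<close>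

definition aug_boundary :: "'v set \<Rightarrow> ('v set \<Rightarrow> 'f::field) \<Rightarrow> 'v set \<Rightarrow> 'f" where
  "aug_boundary C c B = (\<Sum>u\<in>C - B. (-1) ^ card {x \<in> B. vless x u} * c (insert u B))"

lemma finite_full_simplex: "finite C \<Longrightarrow> finite (full_simplex C)"
  unfolding full_simplex_def by simp

lemma simplicial_complex_full_simplex: "finite C \<Longrightarrow> simplicial_complex (full_simplex C)"
  unfolding simplicial_complex_def full_simplex_def by (auto intro: finite_subset)

text \<open>A face \<open>A\<close> with a vertex \<open>v\<close> such that
  \<open>A - {v} = B\<close> is the same thing as a vertex outside \<open>B\<close> whose insertion
  gives a face. Indexed in this way, the sum no longer mentions \<open>K\<close>, since
  \<open>c\<close> vanishes outside \<open>K\<close>, and an iterated boundary becomes a sum over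
  ordered pairs of inserted vertices.\<close>

lemma boundary_eq_aug_boundary:
  assumes "finite C" "K \<subseteq> full_simplex C" "c \<in> chains K k"
  shows "boundary K c B = (if B = {} then 0 else aug_boundary C c B)"
proof (cases "B = {}")
  case False
  have fin: "finite K" using assms finite_full_simplex finite_subset by blast
  have finA: "finite A" "A \<subseteq> C" if "A \<in> K" for A
    using that assms unfolding full_simplex_def by (auto intro: finite_subset)
  have "boundary K c B =
      (\<Sum>(A, v)\<in>(SIGMA A:K. {v. v \<in> A \<and> A - {v} = B}). (-1) ^ card {u \<in> A. vless u v} * c A)"
    using False unfolding boundary_def
    by (simp, subst sum.Sigma) (auto simp: fin intro: finite_subset finA)
  also have "\<dots> = (\<Sum>u\<in>{u \<in> C - B. insert u B \<in> K}.
      (-1) ^ card {x \<in> B. vless x u} * c (insert u B))"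
  proof (rule sum.reindex_bij_witness[where i = "\<lambda>u. (insert u B, u)" and j = snd])
    fix p assume p: "p \<in> (SIGMA A:K. {v. v \<in> A \<and> A - {v} = B})"
    obtain A v where [simp]: "p = (A, v)" by force
    have A: "A = insert v B" "v \<in> C" "v \<notin> B" "A \<in> K" using p finA(2) by auto
    show "(insert (snd p) B, snd p) = p" using A by simp
    show "snd p \<in> {u \<in> C - B. insert u B \<in> K}" using A by auto
    have "{u \<in> A. vless u v} = {x \<in> B. vless x v}" using A by auto
    then show "(- 1) ^ card {x \<in> B. vless x (snd p)} * c (insert (snd p) B) =
        (case p of (A, v) \<Rightarrow> (- 1) ^ card {u \<in> A. vless u v} * c A)"
      using A by simp
  qed auto
  also have "\<dots> = aug_boundary C c B"
    unfolding aug_boundary_def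
    by (rule sum.mono_neutral_left) (use assms in \<open>auto simp: chains_def\<close>)
  finally show ?thesis using False by simp
qed (simp add: boundary_def)

text \<open>Inserting \<open>u\<close> and \<open>v\<close> in either order produces the same face.
  If \<open>u\<close> is the smaller one, inserting it first shifts the position of \<open>v\<close>
  by one, whereas inserting \<open>v\<close> first leaves the position of \<open>u\<close>
  unchanged; so the two terms cancel.\<close>

lemma aug_boundary_aug_boundary:
  assumes "finite C" "finite B"
  shows "aug_boundary C (aug_boundary C c) B = 0"
proof -
  define s where "s B u = ((-1) ^ card {x \<in> B. vless x u} :: 'b)" for B :: "'a set" and u
  define g where "g u v = s B u * s (insert u B) v * c (insert v (insert u B))" for u v
  have s: "s (insert u B) v = (if vless u v then - s B v else s B v)" if "u \<notin> B" for u v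
  proof -
    have "{x \<in> insert u B. vless x v} =
        (if vless u v then insert u {x \<in> B. vless x v} else {x \<in> B. vless x v})" by auto
    then show ?thesis using that assms by (auto simp: s_def)
  qed
  have g: "g u v + g v u = 0" if "vless u v" "u \<notin> B" "v \<notin> B" for u v
    using that vless_asym[OF that(1)] by (simp add: g_def s insert_commute[of u v])
  let ?P = "SIGMA u:C - B. C - B - {u}"
  let ?L = "{(u, v). u \<in> C - B \<and> v \<in> C - B \<and> vless u v}"
  let ?R = "{(u, v). u \<in> C - B \<and> v \<in> C - B \<and> vless v u}"
  have fin: "finite ?L" "finite ?R"
    by (rule finite_subset[of _ "C \<times> C"], use assms in auto)+
  have P: "?P = ?L \<union> ?R" by (auto dest: vless_linear)
  have "aug_boundary C (aug_boundary C c) B = (\<Sum>u\<in>C - B. \<Sum>v\<in>C - B - {u}. g u v)"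
    unfolding aug_boundary_def g_def s_def
    by (intro sum.cong refl) (auto simp: sum_distrib_left mult.assoc intro!: sum.cong)
  also have "\<dots> = (\<Sum>(u, v)\<in>?P. g u v)"
    by (rule sum.Sigma) (use assms in auto)
  also have "\<dots> = (\<Sum>(u, v)\<in>?L. g u v) + (\<Sum>(u, v)\<in>?R. g u v)"
    unfolding P by (rule sum.union_disjoint) (use fin in \<open>auto dest: vless_asym\<close>)
  also have "(\<Sum>(u, v)\<in>?R. g u v) = (\<Sum>(u, v)\<in>?L. g v u)"
    by (rule sum.reindex_bij_witness[where i = prod.swap and j = prod.swap]) auto
  also have "(\<Sum>(u, v)\<in>?L. g u v) + (\<Sum>(u, v)\<in>?L. g v u) = (\<Sum>(u, v)\<in>?L. g u v + g v u)"
    by (simp add: sum.distrib split_def)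
  also have "\<dots> = 0"
    by (rule sum.neutral) (use g in auto)
  finally show ?thesis .
qed

text \<open>Coning off the least vertex is a contracting homotopy: the new vertex takes position \<open>0\<close>, so
  no signs enter.\<close>

lemma aug_boundary_cone:
  assumes "finite C" "m \<in> C" and least: "\<And>u. u \<in> C \<Longrightarrow> u \<noteq> m \<Longrightarrow> vless m u"
    and supp: "\<And>B. z B \<noteq> 0 \<Longrightarrow> B \<subseteq> C" and cyc: "\<And>B. B \<subseteq> C \<Longrightarrow> aug_boundary C z B = 0"
  shows "aug_boundary C (\<lambda>B. if m \<in> B then z (B - {m}) else 0) B = z B"
proof (cases "B \<subseteq> C")
  case False
  then have "z B = 0" using supp by blast
  moreover have "z (insert u B - {m}) = 0" for u
    using False supp[of "insert u B - {m}"] \<open>m \<in> C\<close> by blast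
  ultimately show ?thesis by (auto simp: aug_boundary_def intro!: sum.neutral)
next
  case True
  have finB: "finite B" using True assms(1) finite_subset by blast
  have none: "\<not> vless u m" if "u \<in> C" for u
    using that least[of u] vless_asym[of m u] by (cases "u = m") auto
  show ?thesis
  proof (cases "m \<in> B")
    case False
    have "aug_boundary C (\<lambda>B. if m \<in> B then z (B - {m}) else 0) B =
        (\<Sum>u\<in>C - B. if u = m then z B else 0)"
      unfolding aug_boundary_def
    proof (intro sum.cong refl)
      fix u assume "u \<in> C - B"
      have "card {x \<in> B. vless x m} = 0" using True none by (auto simp: card_eq_0_iff)
      then show "(- 1) ^ card {x \<in> B. vless x u} *
          (if m \<in> insert u B then z (insert u B - {m}) else 0) = (if u = m then z B else 0)"
        using False by (cases "u = m") auto
    qed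
    then show ?thesis using assms(1,2) False by simp
  next
    case mB: True
    \<comment> \<open>The cycle condition is applied at \<open>B - {m}\<close>. Putting
      \<open>m\<close> back contributes \<open>z B\<close> with sign \<open>1\<close>; the other
      terms are those of the cone at \<open>B\<close> with opposite sign, because \<open>m\<close>
      precedes every \<open>u\<close> and raises its position by one. For \<open>B = {m}\<close> the
      condition used is that the augmentation of \<open>z\<close> vanishes.\<close>
    let ?f = "\<lambda>u. (-1) ^ card {x \<in> B - {m}. vless x u} * z (insert u (B - {m}))"
    have "C - (B - {m}) = insert m (C - B)" using assms(2) by auto
    then have "aug_boundary C z (B - {m}) = (\<Sum>u\<in>insert m (C - B). ?f u)"
      by (simp add: aug_boundary_def)
    also have "\<dots> = ?f m + (\<Sum>u\<in>C - B. ?f u)"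
      using assms(1) mB by (subst sum.insert) auto
    also have "{x \<in> B - {m}. vless x m} = {}" using True none by auto
    finally have zB: "z B + (\<Sum>u\<in>C - B. ?f u) = 0"
      using cyc[of "B - {m}"] True mB by (simp add: insert_absorb subset_iff)
    have "aug_boundary C (\<lambda>B. if m \<in> B then z (B - {m}) else 0) B = (\<Sum>u\<in>C - B. - ?f u)"
      unfolding aug_boundary_def
    proof (intro sum.cong refl)
      fix u assume u: "u \<in> C - B"
      then have "vless m u" using least mB by blast
      then have "{x \<in> B. vless x u} = insert m {x \<in> B - {m}. vless x u}" using mB by auto
      then have "card {x \<in> B. vless x u} = Suc (card {x \<in> B - {m}. vless x u})"
        using finB by simp
      moreover have "insert u B - {m} = insert u (B - {m})" using u mB by blast
      ultimately show "(- 1) ^ card {x \<in> B. vless x u} *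
          (if m \<in> insert u B then z (insert u B - {m}) else 0) = - ?f u"
        using mB by simp
    qed
    also have "\<dots> = - (\<Sum>u\<in>C - B. ?f u)" by (rule sum_negf)
    also have "\<dots> = z B" using zB unfolding add_eq_0_iff by simp
    finally show ?thesis .
  qed
qed


section \<open>Chains and boundaries\<close>

lemma boundary_add: "boundary K (\<lambda>A. c A + c' A) = (\<lambda>B. boundary K c B + boundary K c' B)"
  by (auto simp: boundary_def fun_eq_iff distrib_left sum.distrib)

lemma boundary_diff: "boundary K (\<lambda>A. c A - c' A) = (\<lambda>B. boundary K c B - boundary K c' B)"
  by (auto simp: boundary_def fun_eq_iff right_diff_distrib sum_subtractf)

lemma boundary_scale: "boundary K (\<lambda>A. a * c A) = (\<lambda>B. a * boundary K c B)"
  by (simp add: boundary_def fun_eq_iff sum_distrib_left mult.left_commute)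

lemma boundary_zero [simp]: "boundary K (\<lambda>_. 0) = (\<lambda>_. 0)"
  by (simp add: boundary_def fun_eq_iff)

lemma boundary_lincomb:
  "boundary K (\<lambda>A. \<Sum>i\<in>I. a i * f i A) = (\<lambda>B. \<Sum>i\<in>I. a i * boundary K (f i) B)"
  by (induction I rule: infinite_finite_induct) (simp_all add: boundary_add boundary_scale)

lemma zero_chain [simp]: "(\<lambda>_. 0) \<in> chains K k"
  by (simp add: chains_def)

lemma chains_diff: "c \<in> chains K k \<Longrightarrow> c' \<in> chains K k \<Longrightarrow> (\<lambda>A. c A - c' A) \<in> chains K k"
  unfolding chains_def by (simp, metis diff_self)

lemma chains_mono: "S \<subseteq> K \<Longrightarrow> chains S k \<subseteq> chains K k"
  unfolding chains_def by auto

text \<open>Passing to a larger complex only adds faces with coefficient zero. This permits a single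
  boundary operator for the chains of all subcomplexes.\<close>

lemma boundary_restrict:
  assumes "S \<subseteq> K" "finite K" "c \<in> chains S k"
  shows "boundary S c = boundary K c"
proof
  fix B
  have "c A = 0" if "A \<notin> S" for A using assms that by (auto simp: chains_def)
  then show "boundary S c B = boundary K c B"
    unfolding boundary_def using assms by (auto intro!: sum.mono_neutral_left)
qed

lemma boundaries_eq_image:
  "S \<subseteq> K \<Longrightarrow> finite K \<Longrightarrow> boundaries S k = boundary K ` chains S (k + 1)"
  unfolding boundaries_def by (intro image_cong refl boundary_restrict)

lemma boundaries_mono: "S \<subseteq> K \<Longrightarrow> finite K \<Longrightarrow> boundaries S k \<subseteq> boundaries K k"
  using image_mono[OF chains_mono] by (simp add: boundaries_eq_image[of S K] boundaries_def[of K])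

lemma boundary_chain:
  assumes "simplicial_complex K" "c \<in> chains K k"
  shows "boundary K c \<in> chains K (k - 1)"
proof -
  have "B \<in> K \<and> int (card B) = k" if nz: "boundary K c B \<noteq> 0" for B
  proof -
    have B: "B \<noteq> {}" using nz by (auto simp: boundary_def)
    then obtain A where A: "A \<in> K" "(\<Sum>v | v \<in> A \<and> A - {v} = B.
        (-1) ^ card {u \<in> A. vless u v} * c A) \<noteq> 0"
      using nz by (auto simp: boundary_def elim: sum.not_neutral_contains_not_neutral)
    then obtain v where v: "v \<in> A" "A - {v} = B" "c A \<noteq> 0"
      by (elim sum.not_neutral_contains_not_neutral) auto
    have "int (card A) = k + 1" using v(3) assms(2) by (auto simp: chains_def)
    moreover have fin: "finite A" and "B \<in> K"
      using assms(1) A(1) v(2) B unfolding simplicial_complex_def by (blast, metis Diff_subset)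
    moreover have "card A = Suc (card B)" using card_Suc_Diff1[OF fin v(1)] v(2) by simp
    ultimately show ?thesis by simp
  qed
  then show ?thesis by (auto simp: chains_def)
qed

text \<open>The outer operator evaluates \<open>boundary K c\<close> only at sets
  \<open>insert u B\<close>, which are non-empty, and there the two operators agree. For
  \<open>B = {}\<close> the result says that a boundary has augmentation zero.\<close>

lemma aug_boundary_boundary:
  assumes "finite C" "K \<subseteq> full_simplex C" "c \<in> chains K k" "finite B"
  shows "aug_boundary C (boundary K c) B = 0"
proof -
  have "aug_boundary C (boundary K c) B = aug_boundary C (aug_boundary C c) B"
    unfolding aug_boundary_def[of C _ B]
    by (simp add: boundary_eq_aug_boundary[OF assms(1-3)])
  then show ?thesis using assms aug_boundary_aug_boundary by metis
qed

lemma boundary_cycle: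
  assumes "finite C" "K \<subseteq> full_simplex C" "simplicial_complex K" "c \<in> chains K k"
  shows "boundary K c \<in> cycles K (k - 1)"
proof -
  have "boundary K (boundary K c) B = 0" for B
  proof (cases "B \<subseteq> C")
    case True
    then show ?thesis
      using boundary_eq_aug_boundary[OF assms(1,2) boundary_chain[OF assms(3,4)]]
        aug_boundary_boundary[OF assms(1,2,4)] finite_subset[OF _ assms(1)] by simp
  next
    case False
    have "boundary K (boundary K c) \<in> chains K (k - 1 - 1)"
      using assms boundary_chain by metis
    then show ?thesis using False assms(2) by (auto simp: chains_def full_simplex_def)
  qed
  then show ?thesis using boundary_chain[OF assms(3,4)] by (auto simp: cycles_def)
qed

lemma cycles_diff: "a \<in> cycles K k \<Longrightarrow> b \<in> cycles K k \<Longrightarrow> (\<lambda>A. a A - b A) \<in> cycles K k"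
  by (simp add: cycles_def chains_diff boundary_diff)

lemma zero_cycle [simp]: "(\<lambda>_. 0) \<in> cycles K k"
  by (simp add: cycles_def)

lemma boundaries_diff:
  "a \<in> boundaries K k \<Longrightarrow> b \<in> boundaries K k \<Longrightarrow> (\<lambda>A. a A - b A) \<in> boundaries K k"
  by (auto simp: boundaries_def boundary_diff[symmetric] chains_diff)

lemma zero_boundary [simp]: "(\<lambda>_. 0) \<in> boundaries K k"
  unfolding boundaries_def by (rule image_eqI[where x = "\<lambda>_. 0"]) auto

lemma boundaries_uminus: "a \<in> boundaries K k \<Longrightarrow> (\<lambda>A. - a A) \<in> boundaries K k"
  using boundaries_diff[of "\<lambda>_. 0" K k a] by simp

lemma boundaries_add:
  "a \<in> boundaries K k \<Longrightarrow> b \<in> boundaries K k \<Longrightarrow> (\<lambda>A. a A + b A) \<in> boundaries K k"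
  using boundaries_diff[of a K k "\<lambda>A. - b A"] boundaries_uminus[of b K k] by simp


section \<open>Homology at the level of chains\<close>

text \<open>Makes sense for arbitrary \<open>z\<close>, so that the rules for classes are plain
  equations and being a cycle enters only through the carrier.\<close>

definition hclass :: "'v set set \<Rightarrow> int \<Rightarrow> ('v set \<Rightarrow> 'f::field) \<Rightarrow> ('v set \<Rightarrow> 'f) set" where
  "hclass K k z = boundaries K k #>\<^bsub>cycle_group K k\<^esub> z"

lemma hclass_eq: "hclass K k z = {c. (\<lambda>A. c A - z A) \<in> boundaries K k}"
proof -
  have "c \<in> hclass K k z \<longleftrightarrow> (\<lambda>A. c A - z A) \<in> boundaries K k" for c
  proof
    assume "c \<in> hclass K k z"
    then show "(\<lambda>A. c A - z A) \<in> boundaries K k"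
      by (auto simp: hclass_def r_coset_def cycle_group_def)
  next
    assume *: "(\<lambda>A. c A - z A) \<in> boundaries K k"
    show "c \<in> hclass K k z"
      unfolding hclass_def r_coset_def cycle_group_def using * by (auto intro!: bexI[OF _ *])
  qed
  then show ?thesis by blast
qed

lemma hclass_eq_iff: "hclass K k a = hclass K k b \<longleftrightarrow> (\<lambda>A. a A - b A) \<in> boundaries K k"
proof
  assume "hclass K k a = hclass K k b"
  moreover have "a \<in> hclass K k a" by (simp add: hclass_eq)
  ultimately show "(\<lambda>A. a A - b A) \<in> boundaries K k" by (simp add: hclass_eq)
next
  assume ab: "(\<lambda>A. a A - b A) \<in> boundaries K k"
  have "(\<lambda>A. c A - a A) \<in> boundaries K k \<longleftrightarrow> (\<lambda>A. c A - b A) \<in> boundaries K k" for c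
    using boundaries_add[OF _ ab, of "\<lambda>A. c A - a A"] boundaries_diff[OF _ ab, of "\<lambda>A. c A - b A"]
    by auto
  then show "hclass K k a = hclass K k b" by (simp add: hclass_eq)
qed

lemma carrier_homology_group: "carrier (homology_group K k) = hclass K k ` cycles K k"
  by (auto simp: homology_group_def FactGroup_def RCOSETS_def hclass_def cycle_group_def)

lemma mult_homology_group:
  "hclass K k a \<otimes>\<^bsub>homology_group K k\<^esub> hclass K k b = hclass K k (\<lambda>A. a A + b A)"
proof -
  have "hclass K k a \<otimes>\<^bsub>homology_group K k\<^esub> hclass K k b =
      {\<lambda>A. x A + y A | x y. x \<in> hclass K k a \<and> y \<in> hclass K k b}"
    by (auto simp: homology_group_def FactGroup_def set_mult_def cycle_group_def)
  also have "\<dots> = hclass K k (\<lambda>A. a A + b A)"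
  proof (intro equalityI subsetI)
    fix c assume "c \<in> {\<lambda>A. x A + y A | x y. x \<in> hclass K k a \<and> y \<in> hclass K k b}"
    then obtain x y where c: "c = (\<lambda>A. x A + y A)"
      and "(\<lambda>A. x A - a A) \<in> boundaries K k" "(\<lambda>A. y A - b A) \<in> boundaries K k"
      by (auto simp: hclass_eq)
    from boundaries_add[OF this(2,3)] show "c \<in> hclass K k (\<lambda>A. a A + b A)"
      by (simp add: hclass_eq c algebra_simps)
  next
    fix c assume "c \<in> hclass K k (\<lambda>A. a A + b A)"
    then have "(\<lambda>A. c A - b A) \<in> hclass K k a" by (simp add: hclass_eq algebra_simps)
    moreover have "b \<in> hclass K k b" by (simp add: hclass_eq)
    ultimately show "c \<in> {\<lambda>A. x A + y A | x y. x \<in> hclass K k a \<and> y \<in> hclass K k b}"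
      by (intro CollectI exI[of _ "\<lambda>A. c A - b A"] exI[of _ b]) simp
  qed
  finally show ?thesis .
qed

lemma homology_vanishes_iff:
  "homology_vanishes TYPE('f::field) K k \<longleftrightarrow>
     (cycles K k :: ('v set \<Rightarrow> 'f) set) \<subseteq> boundaries K k"
proof -
  let ?H = "homology_group K k :: ('v set \<Rightarrow> 'f) set monoid"
  have one: "\<one>\<^bsub>?H\<^esub> = hclass K k (\<lambda>_. 0)"
    by (auto simp: homology_group_def FactGroup_def hclass_eq)
  have triv: "carrier ?H = {\<one>\<^bsub>?H\<^esub>} \<longleftrightarrow> (cycles K k :: ('v set \<Rightarrow> 'f) set) \<subseteq> boundaries K k"
    (is "?L \<longleftrightarrow> ?R")
  proof
    assume ?L
    then have "\<forall>z\<in>cycles K k. hclass K k z = hclass K k ((\<lambda>_. 0) :: 'v set \<Rightarrow> 'f)"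
      unfolding carrier_homology_group one by blast
    then show ?R by (auto simp: hclass_eq_iff)
  next
    assume ?R
    then have "\<forall>z\<in>cycles K k. hclass K k z = hclass K k ((\<lambda>_. 0) :: 'v set \<Rightarrow> 'f)"
      by (auto simp: hclass_eq_iff)
    then show ?L unfolding carrier_homology_group one using zero_cycle by blast
  qed
  \<comment> \<open>\<open>trivial_group\<close> includes the group axioms. For an arbitrary set
    \<open>K\<close> boundaries may fail to be cycles, so the general theorem on quotient groups
    does not apply; once the carrier consists of the unit alone, the axioms follow from the unit
    being idempotent.\<close>
  have "group ?H" if eq: "carrier ?H = {\<one>\<^bsub>?H\<^esub>}"
  proof (rule groupI)
    have m: "\<one>\<^bsub>?H\<^esub> \<otimes>\<^bsub>?H\<^esub> \<one>\<^bsub>?H\<^esub> = \<one>\<^bsub>?H\<^esub>" by (simp add: one mult_homology_group)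
    show "\<And>x y. \<lbrakk>x \<in> carrier ?H; y \<in> carrier ?H\<rbrakk> \<Longrightarrow> x \<otimes>\<^bsub>?H\<^esub> y \<in> carrier ?H" "\<one>\<^bsub>?H\<^esub> \<in> carrier ?H"
      "\<And>x y z. \<lbrakk>x \<in> carrier ?H; y \<in> carrier ?H; z \<in> carrier ?H\<rbrakk> \<Longrightarrow>
         x \<otimes>\<^bsub>?H\<^esub> y \<otimes>\<^bsub>?H\<^esub> z = x \<otimes>\<^bsub>?H\<^esub> (y \<otimes>\<^bsub>?H\<^esub> z)"
      "\<And>x. x \<in> carrier ?H \<Longrightarrow> \<one>\<^bsub>?H\<^esub> \<otimes>\<^bsub>?H\<^esub> x = x"
      "\<And>x. x \<in> carrier ?H \<Longrightarrow> \<exists>y\<in>carrier ?H. y \<otimes>\<^bsub>?H\<^esub> x = \<one>\<^bsub>?H\<^esub>"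
      unfolding eq using m by simp_all
  qed
  then show ?thesis using triv by (auto simp: homology_vanishes_def trivial_group_def)
qed

section \<open>Maps induced on homology\<close>

lemma chain_map_add: "chain_map f K (\<lambda>A. a A + b A) = (\<lambda>B. chain_map f K a B + chain_map f K b B)"
  by (simp add: chain_map_def fun_eq_iff distrib_left sum.distrib)

lemma chain_map_diff: "chain_map f K (\<lambda>A. a A - b A) = (\<lambda>B. chain_map f K a B - chain_map f K b B)"
  by (simp add: chain_map_def fun_eq_iff right_diff_distrib sum_subtractf)

text \<open>The induced map is additive, so injectivity amounts to a trivial kernel, which is the
  first conjunct; the second is surjectivity, with classes compared through differences of
  representatives.\<close>

lemma induces_homology_iso_iff:
  fixes f :: "'v \<Rightarrow> 'u" and K :: "'v set set" and L :: "'u set set"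
  assumes cyc: "\<And>z :: 'v set \<Rightarrow> 'f::field. z \<in> cycles K k \<Longrightarrow> chain_map f K z \<in> cycles L k"
    and bnd: "\<And>z :: 'v set \<Rightarrow> 'f. z \<in> boundaries K k \<Longrightarrow> chain_map f K z \<in> boundaries L k"
  shows "induces_homology_iso TYPE('f) f K L k \<longleftrightarrow>
     (\<forall>z\<in>cycles K k. chain_map f K z \<in> (boundaries L k :: ('u set \<Rightarrow> 'f) set) \<longrightarrow>
        z \<in> boundaries K k) \<and>
     (\<forall>y\<in>cycles L k. \<exists>z\<in>cycles K k. (\<lambda>B. (y B :: 'f) - chain_map f K z B) \<in> boundaries L k)"
proof -
  let ?h = "homology_map f K L k :: ('v set \<Rightarrow> 'f) set \<Rightarrow> ('u set \<Rightarrow> 'f) set"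
  let ?\<phi> = "chain_map f K :: ('v set \<Rightarrow> 'f) \<Rightarrow> 'u set \<Rightarrow> 'f"
  \<comment> \<open>As boundaries go to boundaries, all representatives of a class yield the same
    coset, and \<open>the_elem\<close> is applied to a singleton.\<close>
  have h: "?h (hclass K k z) = hclass L k (?\<phi> z)" for z
  proof -
    have "hclass L k (?\<phi> c) = hclass L k (?\<phi> z)" if "c \<in> hclass K k z" for c
      using that bnd by (simp add: hclass_eq[of K] hclass_eq_iff chain_map_diff[symmetric])
    moreover have "z \<in> hclass K k z" by (simp add: hclass_eq)
    ultimately have "(\<lambda>c. hclass L k (?\<phi> c)) ` hclass K k z = {hclass L k (?\<phi> z)}" by blast
    then show ?thesis unfolding homology_map_def hclass_def[of L, symmetric] by simp
  qed
  have hom: "?h \<in> hom (homology_group K k) (homology_group L k)"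
    unfolding hom_def carrier_homology_group
    by (auto simp: h mult_homology_group chain_map_add cyc)
  have "inj_on ?h (hclass K k ` cycles K k) \<longleftrightarrow>
      (\<forall>z\<in>cycles K k. ?\<phi> z \<in> boundaries L k \<longrightarrow> z \<in> boundaries K k)" (is "?I \<longleftrightarrow> ?Z")
  proof
    assume I: ?I
    show ?Z
    proof (intro ballI impI)
      fix z :: "'v set \<Rightarrow> 'f" assume z: "z \<in> cycles K k" "?\<phi> z \<in> boundaries L k"
      have "?\<phi> (\<lambda>_. 0) = (\<lambda>_. 0)" by (simp add: chain_map_def fun_eq_iff)
      then have "?h (hclass K k z) = ?h (hclass K k (\<lambda>_. 0))"
        using z by (simp add: h hclass_eq_iff)
      then have "hclass K k z = hclass K k (\<lambda>_. 0)"
        by (rule inj_onD[OF I]) (use z(1) in auto)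
      then show "z \<in> boundaries K k" by (simp add: hclass_eq_iff)
    qed
  next
    assume ?Z
    then show ?I
      by (auto simp: inj_on_def h hclass_eq_iff chain_map_diff[symmetric] cycles_diff)
  qed
  moreover have "?h ` (hclass K k ` cycles K k) = hclass L k ` cycles L k \<longleftrightarrow>
      (\<forall>y\<in>cycles L k. \<exists>z\<in>cycles K k. (\<lambda>B. y B - ?\<phi> z B) \<in> boundaries L k)"
  proof -
    have img: "?h ` (hclass K k ` cycles K k) = (\<lambda>z. hclass L k (?\<phi> z)) ` cycles K k"
      by (simp add: image_image h)
    have "(\<lambda>z. hclass L k (?\<phi> z)) ` cycles K k \<subseteq> hclass L k ` cycles L k" using cyc by auto
    moreover have "hclass L k ` cycles L k \<subseteq> (\<lambda>z. hclass L k (?\<phi> z)) ` cycles K k \<longleftrightarrow>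
      (\<forall>y\<in>cycles L k. \<exists>z\<in>cycles K k. (\<lambda>B. y B - ?\<phi> z B) \<in> boundaries L k)"
      by (simp add: image_subset_iff image_iff hclass_eq_iff)
    ultimately show ?thesis unfolding img set_eq_subset by simp
  qed
  ultimately show ?thesis
    unfolding induces_homology_iso_def iso_def bij_betw_def carrier_homology_group
    by (simp add: hom)
qed


section \<open>Forests, trees and fitting complexes via boundaries\<close>

lemma chains_trivial:
  assumes "\<And>A. A \<in> K \<Longrightarrow> int (card A) \<noteq> k + 1"
  shows "chains K k = {\<lambda>_. 0}"
  using assms by (auto simp: chains_def fun_eq_iff)

lemma chains_negative: "simplicial_complex K \<Longrightarrow> k < 0 \<Longrightarrow> chains K k = {\<lambda>_. 0}"
proof (rule chains_trivial)
  fix A assume "simplicial_complex K" "k < 0" "A \<in> K"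
  then have "0 < card A" by (simp add: simplicial_complex_def card_gt_0_iff)
  then show "int (card A) \<noteq> k + 1" using \<open>k < 0\<close> by linarith
qed

text \<open>In dimension at most \<open>d\<close> there are no nonzero
  \<open>(d + 1)\<close>-chains, so the only \<open>d\<close>-boundary is zero and
  \<open>H_d\<close> is the space of \<open>d\<close>-cycles.\<close>

lemma forest_iff:
  "forest TYPE('f::field) d S \<longleftrightarrow> simplicial_complex S \<and> dim_at_most d S \<and>
     cycles S (int d) = {\<lambda>_. 0 :: 'f}"
proof -
  have "boundaries S (int d) = {\<lambda>_. 0 :: 'f}" if "dim_at_most d S"
  proof -
    have "chains S (int d + 1) = {\<lambda>_. 0 :: 'f}"
      by (rule chains_trivial) (use that in \<open>force simp: dim_at_most_def\<close>)
    then show ?thesis by (simp add: boundaries_def)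
  qed
  then have "homology_vanishes TYPE('f) S (int d) \<longleftrightarrow> cycles S (int d) = {\<lambda>_. 0 :: 'f}"
    if "dim_at_most d S"
    using that zero_cycle[of S "int d"] unfolding homology_vanishes_iff by blast
  then show ?thesis unfolding forest_def by blast
qed

lemma chain_map_id:
  assumes "c \<in> chains K k"
  shows "chain_map id K c = c"
proof
  fix B
  have no_inv: "{(u, v). u \<in> A \<and> v \<in> A \<and> vless u v \<and> vless v u} = {}" for A :: "'a set"
    by (auto dest: vless_asym)
  have "{A. A \<in> K \<and> A = B} = (if B \<in> K then {B} else {})" by auto
  then show "chain_map id K c B = c B"
    using assms by (auto simp: chain_map_def no_inv chains_def)
qed

lemma chains_spanning:
  assumes "spanning d Q S" "i \<le> int d - 1"
  shows "chains S i = chains Q i"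
proof -
  have "A \<in> S \<longleftrightarrow> A \<in> Q" if "int (card A) = i + 1" for A
  proof -
    have "A \<in> skeleton (int d - 1) S \<longleftrightarrow> A \<in> skeleton (int d - 1) Q"
      using assms(1) unfolding spanning_def by simp
    then show ?thesis using that assms(2) by (simp add: skeleton_def)
  qed
  then show ?thesis unfolding chains_def by blast
qed

lemma spanning_subset: "spanning d Q S \<Longrightarrow> S \<subseteq> Q" "spanning d Q S \<Longrightarrow> finite Q"
  by (auto simp: spanning_def subcomplex_def simplicial_complex_def)

lemma cycles_spanning:
  assumes "spanning d Q S" "i \<le> int d - 1"
  shows "cycles S i = cycles Q i"
proof -
  have "boundary S c = boundary Q c" if "c \<in> chains Q i" for c :: "'a set \<Rightarrow> 'b"
    using boundary_restrict[OF spanning_subset[OF assms(1)], of c i] that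
    by (simp add: chains_spanning[OF assms])
  then show ?thesis by (auto simp: cycles_def chains_spanning[OF assms])
qed

text \<open>Boundaries in degree \<open>i\<close> come from chains in degree \<open>i + 1\<close>,
  so agreement of the \<open>(d - 1)\<close>-skeleta gives equality one degree less far than for
  cycles. The degree \<open>d - 1\<close> left open is where the \<open>d\<close>-faces
  matter.\<close>

lemma boundaries_spanning:
  assumes "spanning d Q S" "i + 1 \<le> int d - 1"
  shows "boundaries S i = boundaries Q i"
  by (simp add: boundaries_eq_image[OF spanning_subset[OF assms(1)]] chains_spanning[OF assms]
      boundaries_def[of Q])

lemma cycles_mono:
  assumes "S \<subseteq> K" "finite K"
  shows "cycles S k \<subseteq> cycles K k"
  using boundary_restrict[OF assms] chains_mono[OF assms(1)] by (fastforce simp: cycles_def)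

text \<open>Up to degree \<open>d - 1\<close> both complexes have the same cycles, so the inclusion
  is surjective on homology, and it is injective iff the boundaries agree. Below degree
  \<open>d - 1\<close> they agree by the common skeleton.\<close>

lemma fitting_spanning_iff:
  assumes "finite C" "Q \<subseteq> full_simplex C" "spanning d Q S"
  shows "fitting TYPE('f::field) (int d - 1) Q S \<longleftrightarrow>
     boundaries S (int d - 1) = (boundaries Q (int d - 1) :: ('v set \<Rightarrow> 'f) set)"
proof -
  have sub: "subcomplex S Q" using assms(3) by (simp add: spanning_def)
  note SQ = spanning_subset[OF assms(3)]
  have scQ: "simplicial_complex Q" and scS: "simplicial_complex S"
    using sub by (auto simp: subcomplex_def)
  have id: "chain_map id S z = z" if "z \<in> cycles S i" for i and z :: "'v set \<Rightarrow> 'f"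
    using that chain_map_id by (auto simp: cycles_def)
  have bdc: "boundaries K i \<subseteq> (cycles K i :: ('v set \<Rightarrow> 'f) set)"
    if "K \<subseteq> Q" "simplicial_complex K" for i K
    using boundary_cycle[OF assms(1) subset_trans[OF that(1) assms(2)] that(2), of _ "i + 1"]
    by (auto simp: boundaries_def)
  have iso: "induces_homology_iso TYPE('f) id S Q i \<longleftrightarrow>
      boundaries S i = (boundaries Q i :: ('v set \<Rightarrow> 'f) set)" if i: "i \<le> int d - 1" for i
  proof -
    note cyc = cycles_spanning[OF assms(3) i]
    have "induces_homology_iso TYPE('f) id S Q i \<longleftrightarrow>
      (\<forall>z\<in>cycles S i. chain_map id S z \<in> (boundaries Q i :: ('v set \<Rightarrow> 'f) set) \<longrightarrow>
        z \<in> boundaries S i) \<and>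
      (\<forall>y\<in>cycles Q i. \<exists>z\<in>cycles S i. (\<lambda>B. (y B :: 'f) - chain_map id S z B) \<in> boundaries Q i)"
    proof (rule induces_homology_iso_iff)
      show "chain_map id S z \<in> cycles Q i" if "z \<in> cycles S i" for z :: "'v set \<Rightarrow> 'f"
        using that id[OF that] by (simp add: cyc)
      show "chain_map id S z \<in> boundaries Q i" if "z \<in> boundaries S i" for z :: "'v set \<Rightarrow> 'f"
        using that bdc[OF SQ(1) scS] id boundaries_mono[OF SQ] by (metis subsetD)
    qed
    also have "\<dots> \<longleftrightarrow> (\<forall>z\<in>cycles Q i. (z :: 'v set \<Rightarrow> 'f) \<in> boundaries Q i \<longrightarrow> z \<in> boundaries S i)"
    proof -
      have "\<forall>y\<in>cycles Q i. \<exists>z\<in>cycles S i. (\<lambda>B. (y B :: 'f) - chain_map id S z B) \<in> boundaries Q i"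
      proof
        fix y :: "'v set \<Rightarrow> 'f" assume "y \<in> cycles Q i"
        then have "y \<in> cycles S i" by (simp add: cyc)
        moreover have "(\<lambda>B. y B - chain_map id S y B) \<in> boundaries Q i"
          using id[OF calculation] by simp
        ultimately show "\<exists>z\<in>cycles S i. (\<lambda>B. (y B :: 'f) - chain_map id S z B) \<in> boundaries Q i"
          by (intro bexI[of _ y])
      qed
      then show ?thesis using id cyc by auto
    qed
    also have "\<dots> \<longleftrightarrow> boundaries S i = (boundaries Q i :: ('v set \<Rightarrow> 'f) set)"
      using bdc[OF subset_refl scQ] boundaries_mono[OF SQ] by blast
    finally show ?thesis .
  qed
  show ?thesis
  proof
    assume fit: "fitting TYPE('f) (int d - 1) Q S"
    show "boundaries S (int d - 1) = (boundaries Q (int d - 1) :: ('v set \<Rightarrow> 'f) set)"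
    proof (cases "d = 0")
      \<comment> \<open>For \<open>d = 0\<close> the fitting condition ranges over no degree at all;
        the equality in degree \<open>-1\<close> holds because all chains there are zero.\<close>
      case True
      have "boundaries K (- 1) = {\<lambda>_. 0 :: 'f}" if "K \<subseteq> Q" "simplicial_complex K" for K
        using bdc[OF that, of "- 1"] chains_negative[OF that(2), of "- 1"] zero_boundary[of K "- 1"]
        by (auto simp: cycles_def)
      then show ?thesis using True SQ scS scQ by simp
    next
      case False
      then have "int (d - 1) = int d - 1" by simp
      then have "induces_homology_iso TYPE('f) id S Q (int d - 1)"
        using fit unfolding fitting_def by (metis order_refl)
      then show ?thesis using iso by simp
    qed
  next
    assume eq: "boundaries S (int d - 1) = (boundaries Q (int d - 1) :: ('v set \<Rightarrow> 'f) set)"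
    have "boundaries S i = (boundaries Q i :: ('v set \<Rightarrow> 'f) set)" if "i \<le> int d - 1" for i
      using eq boundaries_spanning[OF assms(3), of i] that by (cases "i = int d - 1") auto
    then show "fitting TYPE('f) (int d - 1) Q S"
      using iso sub by (simp add: fitting_def)
  qed
qed

section \<open>Comparison with a point\<close>

lemma unit_set_cases:
  fixes B :: "unit set"
  obtains "B = {}" | "B = {()}"
proof (cases "() \<in> B")
  case True
  then have "B = {()}" by (simp add: set_eq_iff)
  then show ?thesis by (rule that(2))
next
  case False
  then have "B = {}" by (simp add: set_eq_iff)
  then show ?thesis by (rule that(1))
qed

lemma boundary_point_complex [simp]: "boundary point_complex c = (\<lambda>_. 0)"
proof
  show "boundary point_complex c B = 0" for B :: "unit set"
    by (cases "B = {}") (auto simp: boundary_def point_complex_def intro!: sum.neutral)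
qed

lemma boundaries_point_complex [simp]: "boundaries point_complex k = {\<lambda>_. 0}"
  by (auto simp: boundaries_def intro!: image_eqI[OF _ zero_chain])

lemma cycles_point_complex [simp]: "cycles point_complex k = chains point_complex k"
  by (auto simp: cycles_def)

text \<open>A constant map is injective only on single vertices, so the image collects the
  coefficients of the vertices, and their sum is the augmentation.\<close>

lemma chain_map_point:
  assumes "finite C" "S \<subseteq> full_simplex C" "z \<in> chains S k"
  shows "chain_map (\<lambda>_. ()) S z = (\<lambda>B. if B = {()} then aug_boundary C z {} else 0)"
proof
  fix B :: "unit set"
  have ne: "{} \<notin> S" using assms(2) by (auto simp: full_simplex_def)
  have no_inv: "{(u, v). u \<in> A \<and> v \<in> A \<and> vless u v \<and> vless () ()} = {}" for A :: "'a set"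
    by simp
  show "chain_map (\<lambda>_. ()) S z B = (if B = {()} then aug_boundary C z {} else 0)"
  proof (cases "B = {()}")
    case True
    have faces: "{A. A \<in> S \<and> inj_on (\<lambda>_. ()) A \<and> (\<lambda>_. ()) ` A = B} = (\<lambda>v. {v}) ` {v. {v} \<in> S}"
    proof -
      have "A \<in> (\<lambda>v. {v}) ` {v. {v} \<in> S}" if A: "A \<in> S" "inj_on (\<lambda>_. ()) A" for A
      proof -
        obtain v where "v \<in> A" using ne A(1) by fastforce
        then have "A = {v}" using A(2) by (auto simp: inj_on_def)
        then show ?thesis using A by auto
      qed
      then show ?thesis using True by auto
    qed
    have "chain_map (\<lambda>_. ()) S z B = (\<Sum>A\<in>(\<lambda>v. {v}) ` {v. {v} \<in> S}. z A)"
      unfolding chain_map_def faces no_inv by simp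
    also have "\<dots> = (\<Sum>v | {v} \<in> S. z {v})"
      by (subst sum.reindex) auto
    also have "\<dots> = (\<Sum>v\<in>C. z {v})"
      by (rule sum.mono_neutral_left) (use assms in \<open>auto simp: full_simplex_def chains_def\<close>)
    finally show ?thesis using True by (simp add: aug_boundary_def)
  next
    case False
    then have "B = {}" by auto
    then have no_faces: "{A. A \<in> S \<and> inj_on (\<lambda>_. ()) A \<and> (\<lambda>_. ()) ` A = B} = {}" using ne by auto
    show ?thesis using False unfolding chain_map_def no_faces by simp
  qed
qed

text \<open>Cycles of augmentation zero bound in the simplex, and the boundary of a chain has augmentation
  zero, so a spanning complex has the homology of a point in degree \<open>d - 1\<close> iff its \<open>d\<close>-faces already
  produce all boundaries.\<close>

lemma tree_spanning_iff:
  assumes C: "finite C" "C \<noteq> {}" and span: "spanning d (full_simplex C) S"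
  shows "tree TYPE('f::field) d S \<longleftrightarrow> forest TYPE('f) d S \<and>
     boundaries S (int d - 1) = (boundaries (full_simplex C) (int d - 1) :: ('v set \<Rightarrow> 'f) set)"
proof -
  let ?Q = "full_simplex C" and ?k = "int d - 1"
  let ?\<phi> = "chain_map (\<lambda>_. ()) S :: ('v set \<Rightarrow> 'f) \<Rightarrow> unit set \<Rightarrow> 'f"
  note SQ = spanning_subset[OF span]
  have scQ: "simplicial_complex ?Q" using simplicial_complex_full_simplex[OF C(1)] .
  have scS: "simplicial_complex S" using span by (simp add: spanning_def subcomplex_def)
  note cyc = cycles_spanning[OF span order_refl]
  have \<phi>: "?\<phi> z = (\<lambda>B. if B = {()} then aug_boundary C z {} else 0)" if "z \<in> cycles S ?k" for z
    using that chain_map_point[OF C(1) SQ(1)] by (auto simp: cycles_def)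
  have bdQ: "boundaries ?Q ?k \<subseteq> (cycles S ?k :: ('v set \<Rightarrow> 'f) set)"
    using boundary_cycle[OF C(1) subset_refl scQ, of _ "?k + 1"]
    by (auto simp: boundaries_def cyc)
  have aug0: "aug_boundary C z {} = 0" if "z \<in> boundaries ?Q ?k" for z :: "'v set \<Rightarrow> 'f"
    using that aug_boundary_boundary[OF C(1) subset_refl, of _ _ "{}"] by (auto simp: boundaries_def)
  have "induces_homology_iso TYPE('f) (\<lambda>_. ()) S point_complex ?k \<longleftrightarrow>
      (\<forall>z\<in>cycles S ?k. ?\<phi> z \<in> boundaries point_complex ?k \<longrightarrow> z \<in> boundaries S ?k) \<and>
      (\<forall>y\<in>cycles point_complex ?k. \<exists>z\<in>cycles S ?k.
         (\<lambda>B. y B - ?\<phi> z B) \<in> boundaries point_complex ?k)"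
  proof (rule induces_homology_iso_iff)
    fix z :: "'v set \<Rightarrow> 'f" assume z: "z \<in> cycles S ?k"
    \<comment> \<open>The augmentation sees only coefficients of vertices; outside degree
      \<open>0\<close> the image of \<open>z\<close> is therefore zero.\<close>
    have "int d = 1" if nz: "aug_boundary C z {} \<noteq> 0"
    proof -
      have "\<exists>v\<in>C. z {v} \<noteq> 0"
        using nz by (auto simp: aug_boundary_def elim: sum.not_neutral_contains_not_neutral)
      then show ?thesis using z by (auto simp: cycles_def chains_def)
    qed
    then show "?\<phi> z \<in> cycles point_complex ?k"
      unfolding cycles_point_complex by (auto simp: \<phi>[OF z] chains_def point_complex_def)
  next
    fix z :: "'v set \<Rightarrow> 'f" assume "z \<in> boundaries S ?k"
    then have "z \<in> boundaries ?Q ?k" using boundaries_mono[OF SQ] by blast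
    then show "?\<phi> z \<in> boundaries point_complex ?k"
      using \<phi> bdQ aug0 by (auto simp: fun_eq_iff)
  qed
  \<comment> \<open>Surjectivity always holds: the point has nonzero chains only in degree
    \<open>0\<close>, that is for \<open>d = 1\<close>, and there a multiple of any vertex of
    \<open>C\<close> maps to \<open>y\<close>.\<close>
  moreover have "\<exists>z\<in>cycles S ?k. (\<lambda>B. y B - ?\<phi> z B) \<in> boundaries point_complex ?k"
    if y: "y \<in> cycles point_complex ?k" for y :: "unit set \<Rightarrow> 'f"
  proof (cases "d = 1")
    case False
    then have "y = (\<lambda>_. 0)" using y unfolding cycles_point_complex
      by (auto simp: chains_def point_complex_def fun_eq_iff)
    then show ?thesis by (intro bexI[of _ "\<lambda>_. 0"]) (auto simp: \<phi> aug_boundary_def)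
  next
    case True
    obtain v where v: "v \<in> C" using C by blast
    let ?z = "\<lambda>A. if A = {v} then y {()} else 0"
    have "?z \<in> chains ?Q ?k" using True v by (auto simp: chains_def full_simplex_def)
    moreover have "boundary ?Q ?z \<in> chains ?Q (- 1)"
      using boundary_chain[OF scQ calculation] True by simp
    ultimately have z: "?z \<in> cycles S ?k"
      unfolding cyc by (simp add: cycles_def chains_negative[OF scQ])
    have "aug_boundary C ?z {} = y {()}"
      using C v by (simp add: aug_boundary_def)
    moreover have "y {} = 0" using y unfolding cycles_point_complex
      by (auto simp: chains_def point_complex_def)
    ultimately have "y B - ?\<phi> ?z B = 0" for B
      unfolding \<phi>[OF z] by (cases B rule: unit_set_cases) simp_all
    then have "(\<lambda>B. y B - ?\<phi> ?z B) = (\<lambda>_. 0)" by (rule ext)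
    then have "(\<lambda>B. y B - ?\<phi> ?z B) \<in> boundaries point_complex ?k"
      unfolding boundaries_point_complex unfolding singleton_iff .
    then show ?thesis using z by (rule bexI)
  qed
  moreover have "(\<forall>z\<in>cycles S ?k. ?\<phi> z \<in> boundaries point_complex ?k \<longrightarrow> z \<in> boundaries S ?k) \<longleftrightarrow>
      boundaries S ?k = (boundaries ?Q ?k :: ('v set \<Rightarrow> 'f) set)"
  proof
    assume L: "\<forall>z\<in>cycles S ?k. ?\<phi> z \<in> boundaries point_complex ?k \<longrightarrow> z \<in> boundaries S ?k"
    have "z \<in> boundaries S ?k" if "z \<in> boundaries ?Q ?k" for z :: "'v set \<Rightarrow> 'f"
    proof -
      have z: "z \<in> cycles S ?k" using that bdQ by blast
      moreover have "?\<phi> z \<in> boundaries point_complex ?k"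
        unfolding \<phi>[OF z] using aug0[OF that] by (auto simp: fun_eq_iff)
      ultimately show ?thesis using L by blast
    qed
    then show "boundaries S ?k = (boundaries ?Q ?k :: ('v set \<Rightarrow> 'f) set)" using boundaries_mono[OF SQ] by blast
  next
    assume eq: "boundaries S ?k = (boundaries ?Q ?k :: ('v set \<Rightarrow> 'f) set)"
    obtain m where m: "m \<in> C" "\<And>u. u \<in> C \<Longrightarrow> u \<noteq> m \<Longrightarrow> vless m u"
      using finite_has_vless_least[OF C] by blast
    show "\<forall>z\<in>cycles S ?k. ?\<phi> z \<in> boundaries point_complex ?k \<longrightarrow> z \<in> boundaries S ?k"
    proof (intro ballI impI)
      fix z :: "'v set \<Rightarrow> 'f" assume z: "z \<in> cycles S ?k" "?\<phi> z \<in> boundaries point_complex ?k"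
      have zc: "z \<in> chains ?Q ?k" "boundary ?Q z = (\<lambda>_. 0)"
        using z(1) unfolding cyc by (auto simp: cycles_def)
      have "?\<phi> z {()} = 0" using z(2) by simp
      then have "aug_boundary C z {} = 0" by (simp add: \<phi>[OF z(1)])
      \<comment> \<open>The hypothesis on \<open>?\<phi> z\<close> supplies exactly the value at the
        empty face about which \<open>boundary\<close> says nothing.\<close>
      then have aug: "aug_boundary C z B = 0" for B
        using boundary_eq_aug_boundary[OF C(1) subset_refl zc(1), of B] zc(2)
        by (cases "B = {}") auto
      \<comment> \<open>The cone over \<open>z\<close> with apex \<open>m\<close> has one degree
        more, so it exhibits \<open>z\<close> as the boundary of a \<open>d\<close>-chain of the
        simplex, and \<open>eq\<close> carries this over to \<open>S\<close>.\<close>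
      let ?h = "\<lambda>B. if m \<in> B then z (B - {m}) else 0"
      have supp: "B \<subseteq> C \<and> B \<noteq> {} \<and> int (card B) = int d" if "z B \<noteq> 0" for B
        using zc(1) that by (auto simp: chains_def full_simplex_def)
      have "?h B \<noteq> 0 \<longrightarrow> B \<in> ?Q \<and> int (card B) = int d + 1" for B
      proof
        assume nz: "?h B \<noteq> 0"
        then have "m \<in> B" "z (B - {m}) \<noteq> 0" by (auto split: if_splits)
        moreover from this have "B \<subseteq> C" using supp m(1) by blast
        moreover from this have "finite B" using C finite_subset by blast
        ultimately show "B \<in> ?Q \<and> int (card B) = int d + 1"
          using supp[of "B - {m}"] card_Suc_Diff1[of B m] by (auto simp: full_simplex_def)
      qed
      then have h: "?h \<in> chains ?Q (?k + 1)" by (auto simp: chains_def)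
      have "aug_boundary C ?h B = z B" for B
        by (rule aug_boundary_cone[OF C(1) m]) (use supp aug in auto)
      then have "boundary ?Q ?h B = z B" for B
        using boundary_eq_aug_boundary[OF C(1) subset_refl h, of B] supp[of B] by auto
      then have "z = boundary ?Q ?h" by auto
      then show "z \<in> boundaries S ?k" unfolding eq using h by (auto simp: boundaries_def)
    qed
  qed
  ultimately show ?thesis unfolding tree_def by blast
qed


section \<open>Exchange arguments\<close>

text \<open>Closure under faces is automatic: a proper face of a face with at most
  \<open>d + 1\<close> vertices has at most \<open>d\<close> vertices, and \<open>T\<close> contains
  all such faces of \<open>Q\<close>. Hence \<open>d\<close>-faces can be exchanged freely.\<close>

lemma spanning_iff:
  assumes Q: "simplicial_complex Q"
  shows "spanning d Q T \<longleftrightarrow>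
     T \<subseteq> Q \<and> (\<forall>A\<in>T. card A \<le> d + 1) \<and> (\<forall>A\<in>Q. card A \<le> d \<longrightarrow> A \<in> T)"
proof
  assume T: "spanning d Q T"
  have "A \<in> T" if "A \<in> Q" "card A \<le> d" for A
  proof -
    have "A \<in> skeleton (int d - 1) Q" using that by (simp add: skeleton_def)
    then show ?thesis using T by (auto simp: spanning_def skeleton_def)
  qed
  then show "T \<subseteq> Q \<and> (\<forall>A\<in>T. card A \<le> d + 1) \<and> (\<forall>A\<in>Q. card A \<le> d \<longrightarrow> A \<in> T)"
    using T by (auto simp: spanning_def subcomplex_def dim_at_most_def)
next
  assume T: "T \<subseteq> Q \<and> (\<forall>A\<in>T. card A \<le> d + 1) \<and> (\<forall>A\<in>Q. card A \<le> d \<longrightarrow> A \<in> T)"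
  have "B \<in> T" if "A \<in> T" "B \<noteq> {}" "B \<subseteq> A" for A B
  proof (cases "B = A")
    case False
    have A: "A \<in> Q" "card A \<le> d + 1" using that(1) T by auto
    then have fin: "finite A" using Q by (simp add: simplicial_complex_def)
    have "B \<in> Q" using A Q that(2,3) unfolding simplicial_complex_def by blast
    moreover have "card B < card A" using that(3) False fin by (intro psubset_card_mono) auto
    ultimately show ?thesis using T A(2) by simp
  qed (use that in simp)
  moreover have "finite T" using T Q finite_subset unfolding simplicial_complex_def by metis
  moreover have "\<forall>A\<in>T. finite A \<and> A \<noteq> {}"
    using T Q unfolding simplicial_complex_def by (meson subsetD)
  ultimately have "simplicial_complex T" unfolding simplicial_complex_def by blast
  moreover have "skeleton (int d - 1) T = skeleton (int d - 1) Q"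
    using T unfolding skeleton_def by (intro Collect_cong) auto
  ultimately show "spanning d Q T"
    using T Q unfolding spanning_def subcomplex_def dim_at_most_def by blast
qed

lemma spanning_tree_iff:
  assumes "finite C" "C \<noteq> {}"
  shows "spanning_tree TYPE('f::field) d (full_simplex C) T \<longleftrightarrow>
     spanning d (full_simplex C) T \<and> cycles T (int d) = {\<lambda>_. 0 :: 'f} \<and>
     boundaries T (int d - 1) = (boundaries (full_simplex C) (int d - 1) :: ('v set \<Rightarrow> 'f) set)"
proof (cases "spanning d (full_simplex C) T")
  case True
  then have "simplicial_complex T" "dim_at_most d T"
    by (simp_all add: spanning_def subcomplex_def)
  then show ?thesis
    by (simp add: spanning_tree_def True tree_spanning_iff[OF assms True] forest_iff)
qed (simp add: spanning_tree_def)

text \<open>The same conditions as in \<open>spanning_tree_iff\<close>, with \<open>Q\<close> in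
  place of the simplex: the boundaries of the \<open>d\<close>-faces of \<open>S\<close> are
  linearly independent, and they span the \<open>(d - 1)\<close>-boundaries of
  \<open>Q\<close>.\<close>

lemma fitting_spanning_forest_iff:
  assumes "finite C" "Q \<subseteq> full_simplex C"
  shows "fitting_spanning_forest TYPE('f::field) d Q S \<longleftrightarrow>
     spanning d Q S \<and> cycles S (int d) = {\<lambda>_. 0 :: 'f} \<and>
     boundaries S (int d - 1) = (boundaries Q (int d - 1) :: ('v set \<Rightarrow> 'f) set)"
proof (cases "spanning d Q S")
  case True
  then have "simplicial_complex S" "dim_at_most d S"
    by (simp_all add: spanning_def subcomplex_def)
  then show ?thesis
    by (auto simp: fitting_spanning_forest_def True fitting_spanning_iff[OF assms True] forest_iff)
qed (simp add: fitting_spanning_forest_def)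

lemma cycles_trivial_iff:
  assumes "S \<subseteq> Q" "finite Q"
  shows "cycles S k = {\<lambda>_. 0 :: 'f::field} \<longleftrightarrow>
     (\<forall>c\<in>chains S k. boundary Q c = (\<lambda>_. 0 :: 'f) \<longrightarrow> c = (\<lambda>_. 0))"
proof -
  have "boundary S c = boundary Q c" if "c \<in> chains S k" for c :: "'a set \<Rightarrow> 'f"
    using boundary_restrict[OF assms that] .
  then have "cycles S k = {c \<in> chains S k. boundary Q c = (\<lambda>_. 0 :: 'f)}"
    unfolding cycles_def by auto
  then show ?thesis by auto
qed

text \<open>The elimination step: a coefficient of \<open>e\<close> can be cleared with the help of
  a cycle without changing the boundary.\<close>

lemma boundary_add_scaled_cycle:
  assumes "boundary Q g = (\<lambda>_. 0)"
  shows "boundary Q (\<lambda>B. e B + r * g B) = boundary Q e"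
  by (simp add: boundary_add boundary_scale assms)

definition face_chain :: "'v set \<Rightarrow> 'v set \<Rightarrow> 'f::field" where
  "face_chain A B = (if B = A then 1 else 0)"

text \<open>By linearity it suffices to treat single faces: a chain on \<open>F\<close> is a
  combination of \<open>face_chain\<close>s, each of which can be replaced by a chain on
  \<open>T\<close> with the same boundary.\<close>

lemma boundary_image_chains_subset:
  assumes "finite F" "\<And>A. A \<in> F \<Longrightarrow> int (card A) = k + 1 \<Longrightarrow>
      \<exists>e\<in>chains T k. boundary Q e = boundary Q (face_chain A :: 'v set \<Rightarrow> 'f::field)"
  shows "boundary Q ` chains F k \<subseteq> boundary Q ` (chains T k :: ('v set \<Rightarrow> 'f) set)"
proof
  fix x :: "'v set \<Rightarrow> 'f" assume "x \<in> boundary Q ` chains F k"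
  then obtain c where c: "c \<in> chains F k" "x = boundary Q c" by blast
  let ?F = "{A \<in> F. int (card A) = k + 1}"
  have "\<forall>A\<in>?F. \<exists>e. e \<in> chains T k \<and> boundary Q e = boundary Q (face_chain A :: 'v set \<Rightarrow> 'f)"
    using assms(2) by blast
  from bchoice[OF this] obtain e where e: "\<And>A. A \<in> ?F \<Longrightarrow> e A \<in> chains T k"
      "\<And>A. A \<in> ?F \<Longrightarrow> boundary Q (e A) = boundary Q (face_chain A :: 'v set \<Rightarrow> 'f)"
    by blast
  have "c = (\<lambda>B. \<Sum>A\<in>?F. c A * face_chain A B)"
  proof
    fix B
    have "(\<Sum>A\<in>?F. c A * face_chain A B) = (\<Sum>A\<in>?F. if A = B then c A else 0)"
      by (intro sum.cong) (auto simp: face_chain_def)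
    also have "\<dots> = (if B \<in> ?F then c B else 0)"
      by (rule sum.delta) (use assms(1) in simp)
    also have "\<dots> = c B" using c(1) by (auto simp: chains_def)
    finally show "c B = (\<Sum>A\<in>?F. c A * face_chain A B)" ..
  qed
  then have "x = boundary Q (\<lambda>B. \<Sum>A\<in>?F. c A * face_chain A B)" using c(2) by simp
  also have "\<dots> = boundary Q (\<lambda>B. \<Sum>A\<in>?F. c A * e A B)"
    unfolding boundary_lincomb using e(2) by (intro ext sum.cong) auto
  finally have "x = boundary Q (\<lambda>B. \<Sum>A\<in>?F. c A * e A B)" .
  moreover have "(\<lambda>B. \<Sum>A\<in>?F. c A * e A B) \<in> chains T k"
    unfolding chains_def
  proof (intro CollectI allI impI)
    fix B assume "(\<Sum>A\<in>?F. c A * e A B) \<noteq> 0"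
    then obtain A where "A \<in> ?F" "c A * e A B \<noteq> 0" by (rule sum.not_neutral_contains_not_neutral)
    then show "B \<in> T \<and> int (card B) = k + 1" using e(1)[of A] by (auto simp: chains_def)
  qed
  ultimately show "x \<in> boundary Q ` chains T k" by blast
qed

text \<open>Basis exchange: \<open>face_chain A - c\<close> is a cycle through both \<open>A\<close> and \<open>b\<close>, and it serves to
  eliminate either of them from a chain.\<close>

lemma spanning_tree_exchange:
  fixes c :: "'v set \<Rightarrow> 'f::field"
  assumes C: "finite C" "C \<noteq> {}" and M: "spanning_tree TYPE('f) d (full_simplex C) M"
    and A: "A \<in> full_simplex C" "card A = d + 1" "A \<notin> M"
    and c: "c \<in> chains M (int d)"
      "boundary (full_simplex C) c = boundary (full_simplex C) (face_chain A)"
    and b: "c b \<noteq> 0"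
  shows "spanning_tree TYPE('f) d (full_simplex C) (insert A (M - {b}))"
proof -
  let ?Q = "full_simplex C" and ?T = "insert A (M - {b})"
  let ?g = "\<lambda>B. face_chain A B - c B"
  have scQ: "simplicial_complex ?Q" and finQ: "finite ?Q"
    using C simplicial_complex_full_simplex finite_full_simplex by auto
  note M' = M[unfolded spanning_tree_iff[OF C]]
  have MQ: "M \<subseteq> ?Q" using M' spanning_subset by blast
  have bM: "b \<in> M" "int (card b) = int d + 1" using c(1) b by (auto simp: chains_def)
  have cA: "c A = 0" using c(1) A(3) by (auto simp: chains_def)
  have bdg: "boundary ?Q ?g = (\<lambda>_. 0)" by (simp add: boundary_diff c(2))
  have g: "B \<in> insert A M \<and> int (card B) = int d + 1" if "?g B \<noteq> 0" for B
    using that c(1) A by (cases "B = A") (auto simp: face_chain_def chains_def)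
  have gA: "?g A = 1" and gb: "?g b = - c b"
    using cA A(3) bM by (auto simp: face_chain_def)
  have "card b = d + 1" using bM(2) by simp
  then have span: "spanning d ?Q ?T"
    using M' A bM unfolding spanning_iff[OF scQ] by auto
  then have TQ: "?T \<subseteq> ?Q" using spanning_subset by blast
  have "cycles ?T (int d) = {\<lambda>_. 0 :: 'f}"
    unfolding cycles_trivial_iff[OF TQ finQ]
  proof (intro ballI impI)
    fix e :: "'v set \<Rightarrow> 'f" assume e: "e \<in> chains ?T (int d)" "boundary ?Q e = (\<lambda>_. 0)"
    \<comment> \<open>Clears the coefficient at \<open>A\<close>, so that \<open>?e\<close> is a
      chain on \<open>M\<close> and the independence of \<open>M\<close> applies.\<close>
    let ?e = "\<lambda>B. e B + (- e A) * ?g B"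
    have "?e A = 0" using gA by (simp only:) simp
    moreover have "B \<in> insert A M \<and> int (card B) = int d + 1" if "?e B \<noteq> 0" for B
    proof -
      have "e B \<noteq> 0 \<or> ?g B \<noteq> 0" using that by auto
      then show ?thesis using g[of B] e(1) by (auto simp: chains_def)
    qed
    ultimately have "?e \<in> chains M (int d)" unfolding chains_def by blast
    moreover have "boundary ?Q ?e = (\<lambda>_. 0)"
      using boundary_add_scaled_cycle[OF bdg] e(2) by metis
    ultimately have e0: "?e = (\<lambda>_. 0)"
      using M' unfolding cycles_trivial_iff[OF MQ finQ] by blast
    \<comment> \<open>Since \<open>b\<close> has been removed, the coefficient of \<open>?e\<close>
      at \<open>b\<close> is \<open>e A * c b\<close>. It vanishes although \<open>c b\<close> does
      not, so nothing was subtracted from \<open>e\<close>.\<close>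
    have "e b = 0" using e(1) A(3) bM by (auto simp: chains_def)
    then have "e A = 0" using fun_cong[OF e0, of b] gb b by simp
    then show "e = (\<lambda>_. 0)" using e0 by simp
  qed
  moreover have "boundaries ?Q (int d - 1) \<subseteq> (boundaries ?T (int d - 1) :: ('v set \<Rightarrow> 'f) set)"
  proof
    fix x :: "'v set \<Rightarrow> 'f" assume "x \<in> boundaries ?Q (int d - 1)"
    then have "x \<in> boundaries M (int d - 1)" using M' by simp
    then obtain e where e: "e \<in> chains M (int d)" "x = boundary ?Q e"
      unfolding boundaries_eq_image[OF MQ finQ] by auto
    \<comment> \<open>This time \<open>b\<close> is cleared; the factor is dictated by
      \<open>?g b = - c b\<close>.\<close>
    let ?e = "\<lambda>B. e B + (e b / c b) * ?g B"
    have "?e b = 0" using gb b by (simp only:) simp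
    moreover have "B \<in> insert A M \<and> int (card B) = int d + 1" if "?e B \<noteq> 0" for B
    proof -
      have "e B \<noteq> 0 \<or> ?g B \<noteq> 0" using that by auto
      then show ?thesis using g[of B] e(1) by (auto simp: chains_def)
    qed
    ultimately have "?e \<in> chains ?T (int d)" unfolding chains_def by blast
    moreover have "boundary ?Q ?e = x"
      using boundary_add_scaled_cycle[OF bdg] e(2) by metis
    ultimately show "x \<in> boundaries ?T (int d - 1)"
      unfolding boundaries_eq_image[OF TQ finQ] by auto
  qed
  ultimately show ?thesis
    unfolding spanning_tree_iff[OF C] using span boundaries_mono[OF TQ finQ] by blast
qed

text \<open>A \<open>d\<close>-face \<open>A\<close> of the sublevel outside \<open>M\<close> has
  the same boundary as some chain \<open>c\<close> on \<open>M\<close>; together they form the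
  fundamental circuit of \<open>A\<close>. Every face \<open>b\<close> in the support of
  \<open>c\<close> can be exchanged for \<open>A\<close>, so minimality gives
  \<open>w b \<le> w A \<le> \<alpha>\<close>, and \<open>c\<close> already lives on the sublevel
  part of \<open>M\<close>.\<close>

lemma minimal_spanning_tree_sublevel_boundaries:
  fixes C :: "'v set"
  assumes w: "weighted_simplex C w" and M: "minimal_spanning_tree TYPE('f::field) d C w M"
  shows "boundaries {A \<in> M. w A \<le> \<alpha>} (int d - 1) =
    (boundaries (sublevel C w \<alpha>) (int d - 1) :: ('v set \<Rightarrow> 'f) set)"
proof -
  let ?Q = "full_simplex C" and ?M\<alpha> = "{A \<in> M. w A \<le> \<alpha>}" and ?Q\<alpha> = "sublevel C w \<alpha>"
  have C: "finite C" "C \<noteq> {}" using w by (auto simp: weighted_simplex_def)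
  have tree: "spanning_tree TYPE('f) d ?Q M"
    and min: "\<And>T. spanning_tree TYPE('f) d ?Q T \<Longrightarrow> total_weight w M \<le> total_weight w T"
    using M by (auto simp: minimal_spanning_tree_def)
  note M' = tree[unfolded spanning_tree_iff[OF C]]
  have finQ: "finite ?Q" using C finite_full_simplex by blast
  have MQ: "M \<subseteq> ?Q" using M' spanning_subset by blast
  have finM: "finite M" using MQ finQ finite_subset by blast
  have sub: "?M\<alpha> \<subseteq> ?Q\<alpha>" "?Q\<alpha> \<subseteq> ?Q" "?M\<alpha> \<subseteq> ?Q"
    using MQ by (auto simp: sublevel_def)
  have fin\<alpha>: "finite ?Q\<alpha>" using sub finQ finite_subset by blast
  have "\<exists>e\<in>chains ?M\<alpha> (int d). boundary ?Q e = boundary ?Q (face_chain A :: 'v set \<Rightarrow> 'f)"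
    if A: "A \<in> ?Q\<alpha>" "int (card A) = int d + 1" for A
  proof -
    have AQ: "A \<in> ?Q" "w A \<le> \<alpha>" using A by (auto simp: sublevel_def)
    have face: "(face_chain A :: 'v set \<Rightarrow> 'f) \<in> chains L (int d)" if "A \<in> L" for L
      using that A by (auto simp: chains_def face_chain_def)
    have "boundary ?Q (face_chain A :: 'v set \<Rightarrow> 'f) \<in> boundaries M (int d - 1)"
      using M' face[OF AQ(1)] by (auto simp: boundaries_def)
    then obtain c :: "'v set \<Rightarrow> 'f" where c: "c \<in> chains M (int d)"
        "boundary ?Q c = boundary ?Q (face_chain A)"
      unfolding boundaries_eq_image[OF MQ finQ] by auto
    show ?thesis
    proof (cases "A \<in> M")
      case True
      then show ?thesis using AQ(2) by (intro bexI[where x = "face_chain A"] face) auto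
    next
      case False
      have "w b \<le> \<alpha>" if b: "c b \<noteq> 0" for b
      proof (rule ccontr)
        assume "\<not> w b \<le> \<alpha>"
        then have less: "w A < w b" using AQ(2) by simp
        have bM: "b \<in> M" using c(1) b by (auto simp: chains_def)
        have "card A = d + 1" using A(2) by simp
        then have "total_weight w M \<le> total_weight w (insert A (M - {b}))"
          by (intro min spanning_tree_exchange[OF C tree AQ(1) _ False c b])
        also have "\<dots> = w A + (total_weight w M - w b)"
          using False finM bM by (simp add: total_weight_def sum_diff1)
        finally show False using less by simp
      qed
      then have "c \<in> chains ?M\<alpha> (int d)" using c(1) by (auto simp: chains_def)
      then show ?thesis using c(2) by blast
    qed
  qed
  from boundary_image_chains_subset[OF fin\<alpha> this]
  have "boundaries ?Q\<alpha> (int d - 1) \<subseteq> (boundaries ?M\<alpha> (int d - 1) :: ('v set \<Rightarrow> 'f) set)"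
    unfolding boundaries_eq_image[OF sub(2) finQ] boundaries_eq_image[OF sub(3) finQ] by simp
  then show ?thesis using boundaries_mono[OF sub(1) fin\<alpha>] by blast
qed

lemma simplicial_complex_sublevel:
  assumes "weighted_simplex C w"
  shows "simplicial_complex (sublevel C w \<alpha>)"
proof -
  have "B \<in> sublevel C w \<alpha>" if "A \<in> sublevel C w \<alpha>" "B \<noteq> {}" "B \<subseteq> A" for A B
  proof -
    have "A \<in> full_simplex C" "B \<in> full_simplex C" "w A \<le> \<alpha>"
      using that by (auto simp: sublevel_def full_simplex_def)
    moreover from this have "w B \<le> w A" using assms that by (auto simp: weighted_simplex_def)
    ultimately show ?thesis by (auto simp: sublevel_def)
  qed
  moreover have "finite C" using assms by (simp add: weighted_simplex_def)
  moreover from this have "finite (sublevel C w \<alpha>)" by (simp add: sublevel_def finite_full_simplex)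
  moreover have "finite A \<and> A \<noteq> {}" if "A \<in> sublevel C w \<alpha>" for A
    using that finite_subset[OF _ \<open>finite C\<close>] by (auto simp: sublevel_def full_simplex_def)
  ultimately show ?thesis unfolding simplicial_complex_def by blast
qed

text \<open>Applied with \<open>P\<close> saying that the weight is at most \<alpha>, which
  separates the replaceable part of a tree from the part that is kept.\<close>

lemma chains_split:
  assumes "e \<in> chains T k"
  shows "(\<lambda>B. if P B then e B else 0) \<in> chains {A \<in> T. P A} k"
    and "(\<lambda>B. if P B then 0 else e B) \<in> chains {A \<in> T. \<not> P A} k"
    and "boundary Q e =
      (\<lambda>B. boundary Q (\<lambda>B. if P B then e B else 0) B + boundary Q (\<lambda>B. if P B then 0 else e B) B)"
proof -
  have "e = (\<lambda>B. (if P B then e B else 0) + (if P B then 0 else e B))" by auto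
  then show "boundary Q e =
      (\<lambda>B. boundary Q (\<lambda>B. if P B then e B else 0) B + boundary Q (\<lambda>B. if P B then 0 else e B) B)"
    unfolding boundary_add[symmetric] by simp
qed (use assms in \<open>auto simp: chains_def\<close>)

lemma chains_add_union:
  assumes "a \<in> chains S k" "b \<in> chains T k"
  shows "(\<lambda>A. a A + b A) \<in> chains (S \<union> T) k"
proof -
  have "a A \<noteq> 0 \<or> b A \<noteq> 0" if "a A + b A \<noteq> 0" for A using that by auto
  then show ?thesis using assms unfolding chains_def by blast
qed

text \<open>\<open>S\<close> and the light part of \<open>M\<close> generate the same boundaries,
  namely those of the sublevel. So the light part of any chain can be moved from one to the other
  without changing its boundary while its heavy part stays, and independence and generation carry
  over from \<open>M\<close>.\<close>

lemma spanning_tree_swap_sublevel: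
  fixes C :: "'v set"
  assumes w: "weighted_simplex C w" and M: "minimal_spanning_tree TYPE('f::field) d C w M"
    and S: "fitting_spanning_forest TYPE('f) d (sublevel C w \<alpha>) S"
  shows "spanning_tree TYPE('f) d (full_simplex C) (S \<union> {A \<in> M. \<not> w A \<le> \<alpha>})"
proof -
  let ?Q = "full_simplex C" and ?M\<alpha> = "{A \<in> M. w A \<le> \<alpha>}" and ?Q\<alpha> = "sublevel C w \<alpha>"
  let ?U = "{A \<in> M. \<not> w A \<le> \<alpha>}"
  let ?T = "S \<union> ?U"
  have C: "finite C" "C \<noteq> {}" using w by (auto simp: weighted_simplex_def)
  have tree: "spanning_tree TYPE('f) d ?Q M" using M by (simp add: minimal_spanning_tree_def)
  note M' = tree[unfolded spanning_tree_iff[OF C]]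
  have scQ: "simplicial_complex ?Q" and finQ: "finite ?Q"
    using C simplicial_complex_full_simplex finite_full_simplex by auto
  have Q\<alpha>Q: "?Q\<alpha> \<subseteq> ?Q" by (auto simp: sublevel_def)
  note S' = S[unfolded fitting_spanning_forest_iff[OF C(1) Q\<alpha>Q]]
  have MQ: "M \<subseteq> ?Q" and SQ\<alpha>: "S \<subseteq> ?Q\<alpha>" using M' S' spanning_subset by blast+
  have SQ: "S \<subseteq> ?Q" and M\<alpha>Q: "?M\<alpha> \<subseteq> ?Q" using SQ\<alpha> Q\<alpha>Q MQ by auto
  have Sw: "w A \<le> \<alpha>" if "A \<in> S" for A using that SQ\<alpha> by (auto simp: sublevel_def)
  have same: "boundary ?Q ` chains S (int d) = boundary ?Q ` (chains ?M\<alpha> (int d) :: ('v set \<Rightarrow> 'f) set)"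
    using S' minimal_spanning_tree_sublevel_boundaries[OF w M, of \<alpha>]
    unfolding boundaries_eq_image[OF SQ finQ] boundaries_eq_image[OF M\<alpha>Q finQ] by simp
  have span: "spanning d ?Q ?T"
  proof -
    have Ssp: "\<forall>A\<in>S. card A \<le> d + 1" "\<forall>A\<in>?Q\<alpha>. card A \<le> d \<longrightarrow> A \<in> S"
      using S' unfolding spanning_iff[OF simplicial_complex_sublevel[OF w]] by blast+
    have Msp: "\<forall>A\<in>M. card A \<le> d + 1" "\<forall>A\<in>?Q. card A \<le> d \<longrightarrow> A \<in> M"
      using M' unfolding spanning_iff[OF scQ] by blast+
    have "A \<in> ?T" if "A \<in> ?Q" "card A \<le> d" for A
      using that Msp(2) Ssp(2) by (cases "w A \<le> \<alpha>") (auto simp: sublevel_def)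
    then show ?thesis
      using SQ MQ Ssp(1) Msp(1) unfolding spanning_iff[OF scQ] by blast
  qed
  then have TQ: "?T \<subseteq> ?Q" using spanning_subset by blast
  have "cycles ?T (int d) = {\<lambda>_. 0 :: 'f}"
    unfolding cycles_trivial_iff[OF TQ finQ]
  proof (intro ballI impI)
    fix e :: "'v set \<Rightarrow> 'f" assume e: "e \<in> chains ?T (int d)" "boundary ?Q e = (\<lambda>_. 0)"
    let ?e1 = "\<lambda>B. if w B \<le> \<alpha> then e B else 0" and ?e2 = "\<lambda>B. if w B \<le> \<alpha> then 0 else e B"
    note split = chains_split[OF e(1), where P = "\<lambda>B. w B \<le> \<alpha>"]
    have "{A \<in> ?T. w A \<le> \<alpha>} = S" "{A \<in> ?T. \<not> w A \<le> \<alpha>} = ?U" using Sw by auto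
    then have e1: "?e1 \<in> chains S (int d)" and e2: "?e2 \<in> chains ?U (int d)"
      using split(1,2) by auto
    then obtain e1' where e1': "e1' \<in> chains ?M\<alpha> (int d)" "boundary ?Q ?e1 = boundary ?Q e1'"
      using same by (metis (no_types, lifting) image_iff)
    have "?M\<alpha> \<union> ?U = M" by auto
    then have "(\<lambda>B. e1' B + ?e2 B) \<in> chains M (int d)"
      using chains_add_union[OF e1'(1) e2] by simp
    moreover have "boundary ?Q (\<lambda>B. e1' B + ?e2 B) = (\<lambda>_. 0)"
      unfolding boundary_add e1'(2)[symmetric] using split(3)[of ?Q] e(2) by simp
    ultimately have zero: "(\<lambda>B. e1' B + ?e2 B) = (\<lambda>_. 0)"
      using M' unfolding cycles_trivial_iff[OF MQ finQ] by blast
    \<comment> \<open>The two chains have disjoint supports, so their sum vanishes only if both do.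
      This disposes of the heavy part of \<open>e\<close>; its light part then has zero boundary and
      falls to the independence of \<open>S\<close>.\<close>
    have "e1' B = 0 \<and> ?e2 B = 0" for B
    proof -
      have "e1' B = 0 \<or> ?e2 B = 0" using e1'(1) by (auto simp: chains_def)
      then show ?thesis using fun_cong[OF zero, of B] by (metis add.left_neutral add.right_neutral)
    qed
    then have e1'0: "e1' = (\<lambda>_. 0)" and e20: "\<And>B. ?e2 B = 0" by auto
    have "boundary ?Q ?e1 = (\<lambda>_. 0)" using e1'(2) e1'0 by simp
    then have "?e1 = (\<lambda>_. 0)"
      using S' e1 unfolding cycles_trivial_iff[OF SQ finQ] by blast
    then have "e B = 0" for B using e20[of B] fun_cong[of ?e1 "\<lambda>_. 0" B] by (auto split: if_splits)
    then show "e = (\<lambda>_. 0)" by auto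
  qed
  moreover have "boundaries ?Q (int d - 1) \<subseteq> (boundaries ?T (int d - 1) :: ('v set \<Rightarrow> 'f) set)"
  proof
    fix x :: "'v set \<Rightarrow> 'f" assume "x \<in> boundaries ?Q (int d - 1)"
    then have "x \<in> boundaries M (int d - 1)" using M' by simp
    then obtain e where e: "e \<in> chains M (int d)" "x = boundary ?Q e"
      unfolding boundaries_eq_image[OF MQ finQ] by auto
    let ?e1 = "\<lambda>B. if w B \<le> \<alpha> then e B else 0" and ?e2 = "\<lambda>B. if w B \<le> \<alpha> then 0 else e B"
    note split = chains_split[OF e(1), where P = "\<lambda>B. w B \<le> \<alpha>"]
    obtain e1' where e1': "e1' \<in> chains S (int d)" "boundary ?Q ?e1 = boundary ?Q e1'"
      using same split(1) by (metis (no_types, lifting) image_iff)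
    have "(\<lambda>B. e1' B + ?e2 B) \<in> chains ?T (int d)"
      by (rule chains_add_union[OF e1'(1) split(2)])
    moreover have "boundary ?Q (\<lambda>B. e1' B + ?e2 B) = x"
      unfolding boundary_add e1'(2)[symmetric] using split(3)[of ?Q] e(2) by simp
    ultimately show "x \<in> boundaries ?T (int d - 1)"
      unfolding boundaries_eq_image[OF TQ finQ] by auto
  qed
  ultimately show ?thesis
    unfolding spanning_tree_iff[OF C] using span boundaries_mono[OF TQ finQ] by blast
qed

theorem theorem3p7:
  fixes C :: "'v set" and w :: "'v set \<Rightarrow> real" and d :: nat
    and M :: "'v set set" and \<alpha> :: real
  assumes "weighted_simplex C w"
    and "minimal_spanning_tree TYPE('f::field) d C w M"
  shows "fitting_spanning_forest TYPE('f) d (sublevel C w \<alpha>) {A \<in> M. w A \<le> \<alpha>} \<and>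
    (\<forall>S. fitting_spanning_forest TYPE('f) d (sublevel C w \<alpha>) S \<longrightarrow>
       total_weight w {A \<in> M. w A \<le> \<alpha>} \<le> total_weight w S)"
proof (intro conjI allI impI)
  let ?Q = "full_simplex C" and ?M\<alpha> = "{A \<in> M. w A \<le> \<alpha>}" and ?Q\<alpha> = "sublevel C w \<alpha>"
  let ?U = "{A \<in> M. \<not> w A \<le> \<alpha>}"
  have C: "finite C" "C \<noteq> {}" using assms(1) by (auto simp: weighted_simplex_def)
  have tree: "spanning_tree TYPE('f) d ?Q M"
    using assms(2) by (simp add: minimal_spanning_tree_def)
  note M' = tree[unfolded spanning_tree_iff[OF C]]
  have scQ: "simplicial_complex ?Q" and finQ: "finite ?Q"
    using C simplicial_complex_full_simplex finite_full_simplex by auto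
  have MQ: "M \<subseteq> ?Q" using M' spanning_subset by blast
  have finM: "finite M" using MQ finQ finite_subset by blast
  have Q\<alpha>Q: "?Q\<alpha> \<subseteq> ?Q" by (auto simp: sublevel_def)
  have "spanning d ?Q\<alpha> ?M\<alpha>"
    unfolding spanning_iff[OF simplicial_complex_sublevel[OF assms(1)]]
    using M' by (auto simp: spanning_iff[OF scQ] sublevel_def)
  moreover have "cycles ?M\<alpha> (int d) = {\<lambda>_. 0 :: 'f}"
    using cycles_mono[of ?M\<alpha> M "int d"] finM M' zero_cycle[of ?M\<alpha> "int d"] by blast
  ultimately show "fitting_spanning_forest TYPE('f) d ?Q\<alpha> ?M\<alpha>"
    using minimal_spanning_tree_sublevel_boundaries[OF assms]
    by (simp add: fitting_spanning_forest_iff[OF C(1) Q\<alpha>Q])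
  fix S assume S: "fitting_spanning_forest TYPE('f) d ?Q\<alpha> S"
  have SQ\<alpha>: "S \<subseteq> ?Q\<alpha>" "finite ?Q\<alpha>"
    using S spanning_subset by (auto simp: fitting_spanning_forest_def)
  have finS: "finite S" using SQ\<alpha> finite_subset by blast
  \<comment> \<open>Adding the heavy faces \<open>?U\<close> completes both forests to spanning
    trees, so the claim becomes the minimality of \<open>M\<close>. The weight of \<open>?U\<close>
    cancels because \<open>?U\<close> is disjoint from the sublevel and thus from
    \<open>S\<close>.\<close>
  have "total_weight w ?M\<alpha> + total_weight w ?U = total_weight w (?M\<alpha> \<union> ?U)"
    unfolding total_weight_def by (rule sum.union_disjoint[symmetric]) (use finM in auto)
  also have "?M\<alpha> \<union> ?U = M" by auto
  also have "total_weight w M \<le> total_weight w (S \<union> ?U)"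
    using assms(2) spanning_tree_swap_sublevel[OF assms S] by (simp add: minimal_spanning_tree_def)
  also have "\<dots> = total_weight w S + total_weight w ?U"
    unfolding total_weight_def
    by (rule sum.union_disjoint) (use finS finM SQ\<alpha> in \<open>auto simp: sublevel_def\<close>)
  finally show "total_weight w ?M\<alpha> \<le> total_weight w S" by simp
qed

end
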